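(* If $n=pqr$, with $p$ and $q$ distinct odd primes and $r\geq 2$ an integer, then there exists a sporadic Reinhardt polygon with $n$ sides, that is, $E_1(n)>0$.
   Context: A Reuleaux polygon is a closed convex region in the plane of constant width whose boundary consists of a finite number of circular arcs, each with the same curvature; its vertices are the points where two adjacent arcs of its boundary meet (there is an odd number of them). Connecting all pairs of vertices of a Reuleaux polygon $R$ at maximal distance from one another gives a star polygon $S$: a closed path consisting of an odd number of line segments, each intersecting all the others, all of length equal to the diameter of $R$; the angles at its vertices sum to $\pi$. Let $n\ge 3$ be an integer, not a power of two. A Reinhardt polygon with $n$ sides is an equilateral convex $n$-gon $P$ that can be inscribed in a Reuleaux polygon $R$ having the same diameter as $P$ in such a way that every vertex of $R$ is a vertex of $P$. If $S$ has $m$ vertices ($m$ odd), the angle of $S$ at each vertex $v$ equals $k\pi/n$, where $k$ is the number of sides of $P$ inscribed in the arc of $R$ opposite $v$. Reading off these integers while traversing $S$ gives a composition $[k_1,\dots,k_m]$ of $n$ into an odd number $m$ of positive parts. Two compositions are equivalent if one is obtained from the other by a combination of cyclic shifts and list reversals (corresponding to rotations and flips of the polygon); an equivalence class is called a dihedral composition. Characterization (Reinhardt): a composition $[k_1,\dots,k_m]$ of $n$ with $m$ odd corresponds to a Reinhardt polygon if and only if $\Phi_{2n}(z)$ divides $F(z)=1-z^{k_1}+z^{k_1+k_2}-\cdots+z^{k_1+\cdots+k_{m-1}}$, where $\Phi_j$ is the $j$th cyclotomic polynomial. A Reinhardt polygon is periodic if its dihedral composition is periodic, i.e. has the form $[(k_1,\dots,k_s)^d]$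 (the list $k_1,\dots,k_s$ repeated $d$ times) for some integer $d>1$; otherwise it is sporadic. $E_1(n)$ denotes the number of sporadic Reinhardt polygons with $n$ sides, two polygons being counted as distinct only if one cannot be obtained from the other by a combination of rotations and flips (i.e. one counts the corresponding dihedral compositions). *)

theory Defs
  imports "HOL-Complex_Analysis.Complex_Analysis" "HOL-Computational_Algebra.Primes"
begin

text \<open>The Euclidean plane is \<^typ>\<open>complex\<close>, with its real inner product.\<close>

text \<open>The difference of the two extrema is the distance between the two supporting lines of
  \<open>K\<close> that are perpendicular to \<open>u\<close>.\<close>

definition constant_width :: "real \<Rightarrow> complex set \<Rightarrow> bool" where
  "constant_width w K \<longleftrightarrow> bounded K \<and> K \<noteq> {} \<and>
     (\<forall>u. norm u = 1 \<longrightarrow> (SUP x\<in>K. u \<bullet> x) - (INF x\<in>K. u \<bullet> x) = w)"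

text \<open>The boundary of \<open>R\<close> is the cyclic concatenation of \<open>m\<close> circular arcs of the common radius
  \<open>\<rho>\<close>; the \<open>i\<close>-th one has centre \<open>c i\<close> and runs counterclockwise from angle \<open>s i\<close> to angle
  \<open>t i\<close>.  Distinct arcs overlap in common end points only.  Consecutive arcs lie on different
  circles, so that arcs are not artificially subdivided and every junction is a genuine vertex;
  this also excludes the disc.\<close>

definition arc_boundary ::
    "complex set \<Rightarrow> real \<Rightarrow> nat \<Rightarrow> (nat \<Rightarrow> complex) \<Rightarrow> (nat \<Rightarrow> real) \<Rightarrow> (nat \<Rightarrow> real) \<Rightarrow> bool" where
  "arc_boundary R \<rho> m c s t \<longleftrightarrow>
     (let A = (\<lambda>i. part_circlepath (c i) \<rho> (s i) (t i)) in
       0 < \<rho> \<and> 0 < m \<and>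
       (\<forall>i<m. s i < t i \<and> t i < s i + 2 * pi) \<and>
       frontier R = (\<Union>i<m. path_image (A i)) \<and>
       (\<forall>i<m. pathfinish (A i) = pathstart (A (Suc i mod m))) \<and>
       (\<forall>i<m. \<forall>j<m. i \<noteq> j \<longrightarrow> path_image (A i) \<inter> path_image (A j) \<subseteq>
          {pathstart (A i), pathfinish (A i)} \<inter> {pathstart (A j), pathfinish (A j)}) \<and>
       (\<forall>i<m. c i \<noteq> c (Suc i mod m)))"

text \<open>\<open>R\<close> is a Reuleaux polygon and \<open>V\<close> is the set of its vertices.\<close>

definition reuleaux_polygon :: "complex set \<Rightarrow> complex set \<Rightarrow> bool" where
  "reuleaux_polygon R V \<longleftrightarrow>
     closed R \<and> convex R \<and> interior R \<noteq> {} \<and> (\<exists>w. constant_width w R) \<and>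
     (\<exists>\<rho> m c s t. arc_boundary R \<rho> m c s t \<and>
        V = (\<lambda>i. pathstart (part_circlepath (c i) \<rho> (s i) (t i))) ` {..<m})"

text \<open>Every boundary arc of a Reuleaux polygon is centred at a vertex and has radius equal to the
  diameter (the constant width); the arc opposite a vertex \<open>v\<close> is the one centred at \<open>v\<close>.\<close>

definition opposite_arc :: "complex set \<Rightarrow> complex \<Rightarrow> complex set" where
  "opposite_arc R v = {x \<in> frontier R. dist v x = diameter R}"

text \<open>A list \<open>ws\<close> traverses the star polygon of \<open>R\<close>: it runs once through all vertices of \<open>R\<close>, and
  the segments joining (cyclically) consecutive entries are precisely those joining two vertices
  at maximal distance.\<close>

definition star_traversal :: "complex set \<Rightarrow> complex set \<Rightarrow> complex list \<Rightarrow> bool" where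
  "star_traversal R V ws \<longleftrightarrow>
     set ws = V \<and> distinct ws \<and> odd (length ws) \<and>
     (\<forall>i<length ws. \<forall>j<length ws.
        dist (ws ! i) (ws ! j) = diameter R \<longleftrightarrow>
          j = Suc i mod length ws \<or> i = Suc j mod length ws)"

definition vertices :: "complex set \<Rightarrow> complex set" where
  "vertices P = {x. x extreme_point_of P}"

definition convex_ngon :: "nat \<Rightarrow> complex set \<Rightarrow> bool" where
  "convex_ngon n P \<longleftrightarrow> polytope P \<and> aff_dim P = 2 \<and> card (vertices P) = n"

text \<open>The length of a side, being a segment, is its diameter.\<close>

definition equilateral :: "complex set \<Rightarrow> bool" where
  "equilateral P \<longleftrightarrow> (\<exists>l. \<forall>e. e edge_of P \<longrightarrow> diameter e = l)"

definition reinhardt_inscribed :: "nat \<Rightarrow> complex set \<Rightarrow> complex set \<Rightarrow> complex set \<Rightarrow> bool" where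
  "reinhardt_inscribed n P R V \<longleftrightarrow>
     convex_ngon n P \<and> equilateral P \<and> reuleaux_polygon R V \<and>
     diameter R = diameter P \<and> vertices P \<subseteq> frontier R \<and> V \<subseteq> vertices P"

definition reinhardt_polygon :: "nat \<Rightarrow> complex set \<Rightarrow> bool" where
  "reinhardt_polygon n P \<longleftrightarrow> (\<exists>R V. reinhardt_inscribed n P R V)"

definition sides_in_arc :: "complex set \<Rightarrow> complex set \<Rightarrow> nat" where
  "sides_in_arc P A = card {e. e edge_of P \<and> vertices e \<subseteq> A}"

text \<open>\<open>ks\<close> is a composition read off from the Reinhardt polygon \<open>P\<close>; the starting vertex and the
  direction of the traversal are arbitrary.\<close>

definition has_composition :: "nat \<Rightarrow> complex set \<Rightarrow> nat list \<Rightarrow> bool" where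
  "has_composition n P ks \<longleftrightarrow>
     (\<exists>R V ws. reinhardt_inscribed n P R V \<and> star_traversal R V ws \<and>
        ks = map (\<lambda>v. sides_in_arc P (opposite_arc R v)) ws)"

definition dihedral_class :: "nat list \<Rightarrow> nat list set" where
  "dihedral_class ks = {rotate j ks | j. True} \<union> {rotate j (rev ks) | j. True}"

definition periodic_composition :: "nat list \<Rightarrow> bool" where
  "periodic_composition ks \<longleftrightarrow> (\<exists>d>1. \<exists>xs. ks = concat (replicate d xs))"

definition periodic_polygon :: "nat \<Rightarrow> complex set \<Rightarrow> bool" where
  "periodic_polygon n P \<longleftrightarrow> (\<exists>ks. has_composition n P ks \<and> periodic_composition ks)"

definition sporadic_reinhardt_polygon :: "nat \<Rightarrow> complex set \<Rightarrow> bool" where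
  "sporadic_reinhardt_polygon n P \<longleftrightarrow> reinhardt_polygon n P \<and> \<not> periodic_polygon n P"

definition E1 :: "nat \<Rightarrow> nat" where
  "E1 n = card {dihedral_class ks | ks.
     \<exists>P. sporadic_reinhardt_polygon n P \<and> has_composition n P ks}"

end

theory Submission
  imports Defs
begin

text \<open>
  A word \<open>b\<close> on the integers with \<open>b (j + n) = (\<not> b j)\<close> and vanishing weighted sum over the
  \<open>2n\<close>-th roots of unity gives points \<open>v j\<close> of the plane by prescribing
  \<open>v (j + 1) - v j = \<zeta>\<^sup>j\<^sup>+\<^sup>1 - \<zeta>\<^sup>j\<close> if \<open>b j\<close> and \<open>0\<close> otherwise, where \<open>\<zeta> = exp(\<pi> i/n)\<close>.
  Antiperiodicity forces \<open>v j - v (j + n) = \<zeta>\<^sup>j\<close>.  Replacing each chord by the arc of radius 1 about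
  \<open>v (j + n)\<close> yields a curve \<open>\<gamma>\<close> parametrised by its outer normal with
  \<open>\<gamma>(\<theta>) - \<gamma>(\<theta> + \<pi>) = exp(i\<theta>)\<close>, so its convex hull has constant width 1, is a Reuleaux polygon,
  and circumscribes the Reinhardt polygon spanned by the \<open>v j\<close>.

  Periodicity of a composition concerns every Reuleaux polygon circumscribing the given polygon.
  This is handled by the graph of diameters of the polygon: the vertices of a circumscribed Reuleaux
  polygon have at least two neighbours, those of our star are the only such points, and a cycle
  inside an odd cycle is the whole cycle.  Hence all compositions of the polygon agree up to
  rotation and reversal with the run lengths of \<open>b\<close>, and a periodic one would give \<open>b\<close> a period
  smaller than \<open>2n\<close>.

  For \<open>n = p q r\<close> a word of smallest period \<open>2n\<close> is obtained by taking a word of period \<open>2 q r\<close> on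
  the multiples of \<open>r\<close> and one of period \<open>2 p r\<close> elsewhere.
\<close>

subsection \<open>The boundary curve of a word\<close>

lemma periodic_int_mult:
  fixes f :: "int \<Rightarrow> 'a"
  assumes "\<And>j. f (j + c) = f j"
  shows "f (j + c * k) = f j"
proof (induction k rule: int_induct[of _ 0])
  case (step1 i)
  then show ?case using assms[of "j + c * i"] by (simp add: algebra_simps)
next
  case (step2 i)
  then show ?case using assms[of "j + c * (i - 1)"] by (simp add: algebra_simps)
qed simp

lemma aff_dim_subset_doubleton:
  fixes a c :: "'a::euclidean_space"
  assumes "Y \<subseteq> {a, c}" "aff_dim Y = 1"
  shows "Y = {a, c}" "a \<noteq> c"
proof -
  have "Y \<noteq> {}" using assms(2) by auto
  moreover have "Y \<noteq> {x}" for x using assms(2) by auto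
  ultimately show "Y = {a, c}" "a \<noteq> c" using assms(1) by blast+
qed

lemma diameter_closed_segment: "diameter (closed_segment a c) = dist a (c::'a::euclidean_space)"
proof (rule antisym)
  show "diameter (closed_segment a c) \<le> dist a c"
  proof (rule diameter_le)
    fix x y assume "x \<in> closed_segment a c" "y \<in> closed_segment a c"
    then show "norm (x - y) \<le> dist a c"
      using segment_furthest_le[of x a c y] segment_bound[of y a c]
      by (auto simp: dist_norm norm_minus_commute)
  qed simp
  show "dist a c \<le> diameter (closed_segment a c)"
    by (intro diameter_bounded_bound compact_imp_bounded compact_segment) auto
qed

lemma finite_int_Collect [simp]: "finite {j\<in>{a..<c::int}. Q j}"
  by (rule finite_subset[of _ "{a..<c}"]) auto

lemma nth_concat_replicate:
  "i < d * length xs \<Longrightarrow> concat (replicate d xs) ! i = xs ! (i mod length xs)"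
proof (induction d arbitrary: i)
  case (Suc d)
  show ?case
  proof (cases "i < length xs")
    case False
    then show ?thesis using Suc by (simp add: nth_append le_mod_geq)
  qed (simp add: nth_append)
qed simp

text \<open>\<open>b\<close> is the antiperiodic sign word of the polygon, with period \<open>2n\<close>: sector \<open>j\<close> of outer
  normal directions, between the angles \<open>j \<pi>/n\<close> and \<open>(j + 1) \<pi>/n\<close>, belongs to an arc of the Reuleaux
  polygon if \<open>b j\<close> holds, and to one of its vertices otherwise.  The vanishing sum makes the boundary
  curve close up; it is Reinhardt's condition \<open>F(\<zeta>) = 0\<close>, since \<open>1 - \<zeta>\<close> times this sum is,
  up to a root of unity, \<open>2 F(\<zeta>)\<close>.\<close>

locale reinhardt_word =
  fixes n :: int and b :: "int \<Rightarrow> bool"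
  assumes n_ge2: "n \<ge> 2"
    and b_add_n: "b (j + n) \<longleftrightarrow> \<not> b j"
    and b_0: "b 0"
    and sum_b: "(\<Sum>j\<in>{0..<2*n}. of_bool (b j) * cis (pi * of_int j / of_int n)) = 0"
begin

definition E :: "real \<Rightarrow> complex" where
  "E t = cis (pi * t / of_int n)"

text \<open>The vertices are indexed modulo \<open>2n\<close> by outer normals, so each is repeated throughout a run
  of non-arc sectors.\<close>

definition vx :: "int \<Rightarrow> complex" where
  "vx j = (\<Sum>i\<in>{0..<j mod (2*n)}. of_bool (b i) * (E (of_int i + 1) - E (of_int i)))"

text \<open>The boundary point with outer normal \<open>E t\<close>.\<close>

definition bd :: "real \<Rightarrow> complex" where
  "bd t = vx \<lfloor>t\<rfloor> + of_bool (b \<lfloor>t\<rfloor>) * (E t - E (of_int \<lfloor>t\<rfloor>))"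

section \<open>Periodicity of the word, roots of unity, and closing of the curve\<close>

lemma n_pos [simp]: "n > 0" "n \<noteq> 0" "real_of_int n > 0" "real_of_int n \<noteq> 0"
  using n_ge2 by auto

lemma b_add_2n: "b (j + 2 * n) \<longleftrightarrow> b j"
  using b_add_n[of j] b_add_n[of "j + n"] by (simp add: algebra_simps)

lemma b_cong: "j mod (2*n) = k mod (2*n) \<Longrightarrow> b j \<longleftrightarrow> b k"
proof -
  have "b j \<longleftrightarrow> b (j mod (2*n))" for j
    using periodic_int_mult[where f=b and c="2*n" and j="j mod (2*n)" and k="j div (2*n)"] b_add_2n
    by simp
  then show "j mod (2*n) = k mod (2*n) \<Longrightarrow> b j \<longleftrightarrow> b k" by metis
qed

lemma vx_cong: "j mod (2*n) = k mod (2*n) \<Longrightarrow> vx j = vx k"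
  by (simp add: vx_def)

lemma norm_E [simp]: "norm (E t) = 1"
  by (simp add: E_def)

lemma E_neq_0 [simp]: "E t \<noteq> 0"
  using norm_E[of t] by (metis norm_zero zero_neq_one)

lemma E_add_n: "E (t + of_int n) = - E t"
proof -
  have "pi * (t + of_int n) / of_int n = pi * t / of_int n + pi"
    by (simp add: field_simps)
  then show ?thesis by (simp add: E_def flip: cis_mult)
qed

lemma E_diff_n: "E (t - of_int n) = - E t"
  using E_add_n[of "t - of_int n"] by simp

lemma E_add_2n: "E (t + 2 * of_int n) = E t"
  using E_add_n[of t] E_add_n[of "t + of_int n"] by (simp add: algebra_simps)

lemma E_add: "E (s + t) = E s * E t"
  by (simp add: E_def cis_mult add_divide_distrib algebra_simps)

lemma E_cong: "j mod (2*n) = k mod (2*n) \<Longrightarrow> E (of_int j) = E (of_int k)"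
proof -
  have "E (of_int j) = E (of_int (j mod (2*n)))" for j
    using periodic_int_mult[where f="\<lambda>j. E (of_int j)" and c="2*n" and j="j mod (2*n)" and k="j div (2*n)"]
      E_add_2n by simp
  then show "j mod (2*n) = k mod (2*n) \<Longrightarrow> E (of_int j) = E (of_int k)" by metis
qed

lemma inner_E: "E s \<bullet> E t = cos (pi * (t - s) / of_int n)"
proof -
  have "cos (pi * (t - s) / of_int n) = cos (pi * t / of_int n - pi * s / of_int n)"
    by (simp add: diff_divide_distrib right_diff_distrib)
  then show ?thesis
    by (simp add: E_def inner_complex_def cos_diff mult.commute)
qed

lemma E_eq_iff: "E s = E t \<longleftrightarrow> (\<exists>k. t = s + 2 * of_int n * of_int k)"
proof
  assume "E s = E t"
  then have "sin (pi * s / n) = sin (pi * t / n) \<and> cos (pi * s / n) = cos (pi * t / n)"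
    by (simp add: E_def complex_eq_iff)
  then obtain k where "pi * t / n = pi * s / n + 2 * pi * of_int k"
    using sin_cos_eq_iff[of "pi * t / n" "pi * s / n"] by metis
  then have "pi * t = pi * (s + 2 * n * k)" by (simp add: field_simps)
  then show "\<exists>k. t = s + 2 * of_int n * of_int k" by auto
next
  assume "\<exists>k. t = s + 2 * of_int n * of_int k"
  then obtain k where "t = s + 2 * of_int n * of_int k" by blast
  moreover have "E (s + 2 * of_int n * of_int k) = E s"
    using periodic_int_mult[where f="\<lambda>j. E (s + of_int j)" and c="2*n" and j=0 and k=k]
      E_add_2n[of "s + _"] by (simp add: add.assoc)
  ultimately show "E s = E t" by simp
qed

lemma E_int_eq_iff: "E (of_int j) = E (of_int k) \<longleftrightarrow> j mod (2*n) = k mod (2*n)"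
proof
  assume "E (of_int j) = E (of_int k)"
  then obtain l where "real_of_int k = of_int j + 2 * of_int n * of_int l"
    using E_eq_iff by blast
  then have "k = j + 2 * n * l"
    by (metis (no_types, lifting) of_int_add of_int_eq_iff of_int_mult of_int_numeral)
  then show "j mod (2*n) = k mod (2*n)" by simp
qed (rule E_cong)

lemma unit_eq_E: "norm u = 1 \<Longrightarrow> \<exists>t. u = E t"
proof -
  assume "norm u = 1"
  then have "u = cis (Arg u)" using rcis_cmod_Arg[of u] by (simp add: rcis_def)
  then have "u = E (Arg u * n / pi)" by (simp add: E_def)
  then show ?thesis by blast
qed

lemma vx_add_2n [simp]: "vx (j + 2 * n) = vx j"
  by (rule vx_cong) simp

lemma sum_full: "(\<Sum>i\<in>{0..<2*n}. of_bool (b i) * (E (of_int i + 1) - E (of_int i))) = 0"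
proof -
  have "(\<Sum>i\<in>{0..<2*n}. of_bool (b i) * (E (of_int i + 1) - E (of_int i))) =
     (\<Sum>i\<in>{0..<2*n}. (of_bool (b i) * E (of_int i)) * (E 1 - 1))"
    by (intro sum.cong) (auto simp: E_add algebra_simps)
  also have "\<dots> = (\<Sum>i\<in>{0..<2*n}. of_bool (b i) * E (of_int i)) * (E 1 - 1)"
    by (simp only: sum_distrib_right)
  also have "\<dots> = 0"
    using sum_b by (simp only: E_def mult_zero_left)
  finally show ?thesis .
qed

text \<open>When \<open>j + 1\<close> is a multiple of \<open>2n\<close> the definition restarts at
  0; there the closing condition \<open>sum_full\<close> keeps the recursion valid.\<close>

lemma vx_Suc: "vx (j + 1) = vx j + of_bool (b j) * (E (of_int j + 1) - E (of_int j))"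
proof -
  define k where "k = j mod (2*n)"
  have k: "0 \<le> k" "k < 2*n" "k mod (2*n) = j mod (2*n)" by (auto simp: k_def)
  have summand: "of_bool (b j) * (E (of_int j + 1) - E (of_int j))
      = of_bool (b k) * (E (of_int k + 1) - E (of_int k))"
    using b_cong[OF k(3)] E_cong[OF k(3)] by (simp add: E_add)
  have ins: "{0..<k+1} = insert k {0..<k}" using k by auto
  have S: "(\<Sum>i\<in>{0..<k+1}. of_bool (b i) * (E (of_int i + 1) - E (of_int i)))
     = vx j + of_bool (b j) * (E (of_int j + 1) - E (of_int j))"
    unfolding summand by (simp add: ins vx_def flip: k_def)
  show ?thesis
  proof (cases "k + 1 = 2*n")
    case True
    have "(j + 1) mod (2*n) = (k + 1) mod (2*n)" by (simp add: k_def mod_add_left_eq)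
    then have "vx (j + 1) = 0" by (simp add: vx_def True)
    then show ?thesis using S sum_full True by simp
  next
    case False
    have "(j + 1) mod (2*n) = (k + 1) mod (2*n)" by (simp add: k_def mod_add_left_eq)
    also have "\<dots> = k + 1" using k(1,2) False by (intro mod_pos_pos_trivial) linarith+
    finally show ?thesis using S by (simp add: vx_def)
  qed
qed

text \<open>The defect \<open>D\<close> does not change from \<open>j\<close> to
  \<open>j + 1\<close>, because exactly one of the sectors \<open>j\<close> and \<open>j + n\<close>
  contributes a chord. A shift by \<open>n\<close> negates it, so it vanishes.\<close>

lemma vx_diff: "vx j - vx (j + n) = E (of_int j)"
proof -
  define D where "D j = vx j - vx (j + n) - E (of_int j)" for j
  have "D (j + 1) = D j" for j
    using vx_Suc[of j] vx_Suc[of "j + n"] E_add_n[of "of_int j"] E_add_n[of "of_int j + 1"]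
    by (cases "b j") (auto simp: D_def b_add_n algebra_simps)
  then have "D (j + n) = D j"
    using periodic_int_mult[where f=D and c=1 and j=j and k=n] by simp
  moreover have "D (j + n) = - D j"
    using E_add_n[of "of_int j"] vx_add_2n[of j] by (simp add: D_def algebra_simps)
  ultimately have "D j = 0" by simp
  then show ?thesis by (simp add: D_def)
qed

lemma vx_add_n: "vx (j + n) = vx j - E (of_int j)"
  using vx_diff[of j] by (simp add: algebra_simps)

text \<open>The right end point is included: there \<open>bd\<close> already uses the formula of the
  next sector, and the agreement of the two is continuity of the curve.\<close>

lemma bd_sector:
  assumes "of_int j \<le> t" "t \<le> of_int j + 1"
  shows "bd t = vx j + of_bool (b j) * (E t - E (of_int j))"
proof (cases "t = of_int j + 1")
  case True
  then have "\<lfloor>t\<rfloor> = j + 1" by simp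
  then show ?thesis using True vx_Suc[of j] by (simp add: bd_def)
next
  case False
  then have "\<lfloor>t\<rfloor> = j" using assms by (simp add: floor_eq_iff)
  then show ?thesis by (simp add: bd_def)
qed

lemma bd_int [simp]: "bd (of_int j) = vx j"
  by (simp add: bd_def)

lemma bd_add_n: "bd (t + of_int n) = bd t - E t"
proof -
  have "\<lfloor>t + of_int n\<rfloor> = \<lfloor>t\<rfloor> + n" by simp
  then show ?thesis
    using vx_add_n[of "\<lfloor>t\<rfloor>"] E_add_n[of t] E_add_n[of "of_int \<lfloor>t\<rfloor>"]
    by (cases "b \<lfloor>t\<rfloor>") (auto simp: bd_def b_add_n)
qed

lemma bd_add_2n: "bd (t + 2 * of_int n) = bd t"
  using bd_add_n[of t] bd_add_n[of "t + of_int n"] E_add_n[of t] by (simp add: algebra_simps)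

lemma bd_add_2nk: "bd (t + 2 * of_int n * of_int k) = bd t"
  using periodic_int_mult[where f="\<lambda>j. bd (t + of_int j)" and c="2*n" and j=0 and k=k]
      bd_add_2n[of "t + _"] by (simp add: add.assoc)

section \<open>Support directions of the boundary curve\<close>

lemma cos_mono_aux:
  assumes "s \<le> t1" "t1 \<le> t2" "t2 \<le> s + of_int n"
  shows "E s \<bullet> E t2 \<le> E s \<bullet> E t1"
proof -
  have "pi * (t2 - s) \<le> pi * of_int n" using assms by (intro mult_left_mono) auto
  then have "pi * (t2 - s) / of_int n \<le> pi" by (simp add: field_simps)
  moreover have "pi * (t1 - s) / of_int n \<le> pi * (t2 - s) / of_int n" "0 \<le> pi * (t1 - s) / of_int n"
    using assms by (auto intro!: divide_right_mono less_imp_le[OF n_pos(3)] mult_left_mono divide_nonneg_pos)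
  ultimately show ?thesis unfolding inner_E by (intro cos_monotone_0_pi_le)
qed

lemma cos_strict_aux:
  assumes "s \<le> t1" "t1 < t2" "t2 \<le> s + of_int n"
  shows "E s \<bullet> E t2 < E s \<bullet> E t1"
proof -
  have "pi * (t2 - s) \<le> pi * of_int n" using assms by (intro mult_left_mono) auto
  then have "pi * (t2 - s) / of_int n \<le> pi" by (simp add: field_simps)
  moreover have "pi * (t1 - s) / of_int n < pi * (t2 - s) / of_int n" "0 \<le> pi * (t1 - s) / of_int n"
    using assms by (auto intro!: divide_strict_right_mono mult_strict_left_mono divide_nonneg_pos)
  ultimately show ?thesis unfolding inner_E by (intro cos_monotone_0_pi)
qed

text \<open>On an arc sector the curve moves as \<open>E\<close> does, on a vertex sector it rests.
  Hence over the half turn after \<open>s\<close> its component along \<open>E s\<close> can only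
  fall, as the cosine does on \<open>[0, pi]\<close>; the induction runs over the sectors between
  \<open>t1\<close> and \<open>t2\<close>.\<close>

lemma bd_antimono:
  assumes "s \<le> t1" "t1 \<le> t2" "t2 \<le> s + of_int n"
  shows "E s \<bullet> bd t2 \<le> E s \<bullet> bd t1"
  using assms
proof (induction "nat (\<lfloor>t2\<rfloor> - \<lfloor>t1\<rfloor>)" arbitrary: t1)
  have same: "E s \<bullet> bd t2 \<le> E s \<bullet> bd t1"
    if "s \<le> t1" "t1 \<le> t2" "t2 \<le> s + of_int n" "t2 \<le> of_int \<lfloor>t1\<rfloor> + 1" for t1 t2
  proof -
    have "of_int \<lfloor>t1\<rfloor> \<le> t1" "of_int \<lfloor>t1\<rfloor> \<le> t2" "t1 \<le> of_int \<lfloor>t1\<rfloor> + 1"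
      using that by linarith+
    then have "bd t2 - bd t1 = of_bool (b \<lfloor>t1\<rfloor>) * (E t2 - E t1)"
      using bd_sector[of "\<lfloor>t1\<rfloor>" t1] bd_sector[of "\<lfloor>t1\<rfloor>" t2] that
      by (cases "b \<lfloor>t1\<rfloor>") auto
    then have "E s \<bullet> bd t2 - E s \<bullet> bd t1 = of_bool (b \<lfloor>t1\<rfloor>) * (E s \<bullet> E t2 - E s \<bullet> E t1)"
      by (cases "b \<lfloor>t1\<rfloor>") (auto simp flip: inner_diff_right)
    then show ?thesis using cos_mono_aux[OF that(1-3)] by (cases "b \<lfloor>t1\<rfloor>") auto
  qed
  {
    case 0
    then have "\<lfloor>t2\<rfloor> \<le> \<lfloor>t1\<rfloor>" by simp
    then show ?case using 0 by (intro same) linarith+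
  next
    case (Suc k)
    let ?t = "of_int \<lfloor>t1\<rfloor> + 1 :: real"
    have 1: "t1 \<le> ?t" "?t \<le> t2" using Suc(2) by linarith+
    have fl: "\<lfloor>?t\<rfloor> = \<lfloor>t1\<rfloor> + 1" by simp
    have "k = nat (\<lfloor>t2\<rfloor> - \<lfloor>?t\<rfloor>)" using Suc(2) fl by linarith
    then have "E s \<bullet> bd t2 \<le> E s \<bullet> bd ?t" using Suc.prems 1 by (intro Suc.hyps(1)) linarith+
    also have "\<dots> \<le> E s \<bullet> bd t1" using Suc.prems 1 by (intro same) auto
    finally show ?case .
  }
qed

lemma bd_mono:
  assumes "s - of_int n \<le> t1" "t1 \<le> t2" "t2 \<le> s"
  shows "E s \<bullet> bd t1 \<le> E s \<bullet> bd t2"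
  using bd_antimono[of "s - of_int n" t1 t2] assms by (simp add: E_diff_n)

lemma obtain_shift:
  fixes t s :: real
  obtains k where "s \<le> t + 2 * of_int n * of_int k" "t + 2 * of_int n * of_int k < s + 2 * of_int n"
proof
  define k where "k = - \<lfloor>(t - s) / (2 * of_int n)\<rfloor>"
  have "of_int (- k) \<le> (t - s) / (2 * of_int n)" "(t - s) / (2 * of_int n) < of_int (- k) + 1"
    unfolding k_def by linarith+
  then show "s \<le> t + 2 * of_int n * of_int k" "t + 2 * of_int n * of_int k < s + 2 * of_int n"
    by (simp_all add: field_simps)
qed

lemma obtain_shift_int:
  obtains k' where "k' mod (2*n) = k mod (2*n)" "(a::int) \<le> k'" "k' < a + 2 * n"
proof
  show "(a + (k - a) mod (2*n)) mod (2*n) = k mod (2*n)" by (simp add: mod_add_right_eq)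
  show "a \<le> a + (k - a) mod (2*n)" "a + (k - a) mod (2*n) < a + 2 * n" by simp_all
qed

text \<open>Modulo full turns, \<open>t\<close> lies in the half turn after \<open>s\<close> or in
  the one before it, and monotonicity compares it with \<open>s\<close> in both. Thus
  \<open>E s\<close> is an outer normal at \<open>bd s\<close>.\<close>

lemma bd_support: "E s \<bullet> bd t \<le> E s \<bullet> bd s"
proof -
  obtain k where k: "s \<le> t + 2 * of_int n * of_int k" "t + 2 * of_int n * of_int k < s + 2 * of_int n"
    by (rule obtain_shift)
  define t' where "t' = t + 2 * of_int n * of_int k"
  have "E s \<bullet> bd t' \<le> E s \<bullet> bd s"
  proof (cases "t' \<le> s + of_int n")
    case True
    then show ?thesis using bd_antimono[of s s t'] k t'_def by simp
  next
    case False
    have "bd (t' - 2 * of_int n) = bd t'" using bd_add_2n[of "t' - 2 * of_int n"] by simp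
    then show ?thesis using bd_mono[of s "t' - 2 * of_int n" s] False k t'_def by simp
  qed
  then show ?thesis by (simp add: t'_def bd_add_2nk)
qed


lemma n_nonneg [simp]: "n \<ge> 0"
  using n_ge2 by simp

subsection \<open>The body of constant width and the inscribed polygon\<close>

definition R :: "complex set" where
  "R = convex hull (range bd)"

definition X :: "complex set" where
  "X = range vx"

definition P :: "complex set" where
  "P = convex hull X"

lemma bd_in_R [simp]: "bd t \<in> R"
  by (simp add: R_def hull_inc)

lemma vx_in_X [simp]: "vx j \<in> X"
  by (simp add: X_def)

lemma vx_in_P [simp]: "vx j \<in> P"
  by (simp add: P_def hull_inc)

lemma X_subset_bd: "X \<subseteq> range bd"
  unfolding X_def by (metis bd_int image_subsetI rangeI)

lemma X_subset_R: "X \<subseteq> R"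
  using X_subset_bd by (auto simp: R_def intro: hull_inc)

lemma P_subset_R: "P \<subseteq> R"
  unfolding P_def R_def by (intro hull_mono X_subset_bd)

lemma convex_R: "convex R" and convex_P: "convex P"
  by (simp_all add: R_def P_def)

lemma R_support: "y \<in> R \<Longrightarrow> E s \<bullet> y \<le> E s \<bullet> bd s"
proof -
  have "R \<subseteq> {y. E s \<bullet> y \<le> E s \<bullet> bd s}"
    unfolding R_def using bd_support by (intro hull_minimal convex_halfspace_le) auto
  then show "y \<in> R \<Longrightarrow> E s \<bullet> y \<le> E s \<bullet> bd s" by blast
qed

lemma inner_E_E [simp]: "E s \<bullet> E s = 1"
  by (simp add: dot_square_norm)

lemma R_support_opposite: "y \<in> R \<Longrightarrow> E s \<bullet> bd s - 1 \<le> E s \<bullet> y"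
  using R_support[of y "s + of_int n"] by (simp add: E_add_n bd_add_n inner_diff_right)

text \<open>The distance is the difference of the components along the direction of
  \<open>y - z\<close>, and the width in that direction is 1.\<close>

lemma R_dist_le:
  assumes "y \<in> R" "z \<in> R"
  shows "dist y z \<le> 1"
proof (cases "y = z")
  case False
  then obtain s where s: "(y - z) /\<^sub>R norm (y - z) = E s"
    using unit_eq_E[of "(y - z) /\<^sub>R norm (y - z)"] by auto
  have "y - z = norm (y - z) *\<^sub>R E s"
    unfolding s[symmetric] using False by simp
  then have "E s \<bullet> y - E s \<bullet> z = norm (y - z)"
    by (metis inner_diff_right inner_scaleR_right inner_E_E mult.right_neutral)
  then show ?thesis
    using R_support[of y s] R_support_opposite[of z s] assms by (simp add: dist_norm)
qed simp

text \<open>Measured from the antipode \<open>bd (s + n)\<close>, the point \<open>y\<close> has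
  norm at most 1 and component 1 along the unit vector \<open>E s\<close>, so it equals
  \<open>E s\<close>. This is strict convexity of \<open>R\<close>.\<close>

lemma R_support_unique:
  assumes "y \<in> R" "E s \<bullet> bd s \<le> E s \<bullet> y"
  shows "y = bd s"
proof -
  define w where "w = y - bd (s + of_int n)"
  have eq: "w - E s = y - bd s" by (simp add: w_def bd_add_n)
  have "E s \<bullet> w = 1"
    using R_support[OF assms(1), of s] assms(2)
    by (simp add: w_def bd_add_n inner_diff_right)
  moreover have "norm w \<le> 1"
    using R_dist_le[OF assms(1) bd_in_R, of "s + of_int n"] by (simp add: w_def dist_norm)
  then have "w \<bullet> w \<le> 1" by (metis dot_square_norm norm_ge_zero power_le_one)
  ultimately have "(w - E s) \<bullet> (w - E s) \<le> 0"
    by (simp add: inner_diff_left inner_diff_right inner_commute[of w "E s"])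
  then have "w - E s = 0" by (metis inner_gt_zero_iff not_le)
  then show ?thesis using eq by simp
qed

text \<open>By periodicity the sectors of one turn suffice, and each is a continuous image of a
  compact interval.\<close>

lemma compact_bd: "compact (range bd)"
proof -
  let ?A = "\<lambda>j. (\<lambda>t. vx j + of_bool (b j) * (E t - E (of_int j))) ` {of_int j..of_int j + 1}"
  have "range bd = (\<Union>j\<in>{0..<2*n}. ?A j)"
  proof (intro equalityI subsetI)
    fix y assume "y \<in> range bd"
    then obtain t where t: "y = bd t" by blast
    obtain k where k: "0 \<le> t + 2 * of_int n * of_int k" "t + 2 * of_int n * of_int k < 0 + 2 * of_int n"
      by (rule obtain_shift)
    define s where "s = t + 2 * of_int n * of_int k"
    have "y = bd s" by (simp add: t s_def bd_add_2nk)
    moreover have "\<lfloor>s\<rfloor> \<in> {0..<2*n}" using k by (simp add: floor_less_iff flip: s_def)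
    moreover have "s \<in> {of_int \<lfloor>s\<rfloor>..of_int \<lfloor>s\<rfloor> + 1}" by simp
    moreover have "bd s = vx \<lfloor>s\<rfloor> + of_bool (b \<lfloor>s\<rfloor>) * (E s - E (of_int \<lfloor>s\<rfloor>))" by (rule bd_def)
    ultimately show "y \<in> (\<Union>j\<in>{0..<2*n}. ?A j)" by blast
  next
    fix y assume "y \<in> (\<Union>j\<in>{0..<2*n}. ?A j)"
    then obtain j t where "t \<in> {of_int j..of_int j + 1}"
      "y = vx j + of_bool (b j) * (E t - E (of_int j))" by blast
    then have "y = bd t" using bd_sector[of j t] by simp
    then show "y \<in> range bd" by simp
  qed
  moreover have "compact (?A j)" for j
    unfolding E_def by (intro compact_continuous_image continuous_intros) auto
  ultimately show ?thesis by (simp add: compact_UN)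
qed

lemma compact_R: "compact R"
  unfolding R_def using compact_bd by (rule compact_convex_hull)

lemma diameter_eq_1:
  assumes "S \<subseteq> R" "X \<subseteq> S"
  shows "diameter S = 1"
proof (rule antisym)
  show "diameter S \<le> 1"
    using assms R_dist_le by (intro diameter_le) (auto simp: dist_norm subset_iff)
  have "bounded S" using compact_R assms(1) bounded_subset compact_imp_bounded by blast
  then have "dist (vx 0) (vx n) \<le> diameter S"
    using assms(2) by (intro diameter_bounded_bound) auto
  moreover have "dist (vx 0) (vx n) = 1"
    using vx_diff[of 0] by (simp add: dist_norm)
  ultimately show "1 \<le> diameter S" by simp
qed

lemma diameter_R: "diameter R = 1"
  using diameter_eq_1 X_subset_R by blast

lemma diameter_P: "diameter P = 1"
  using diameter_eq_1 P_subset_R by (simp add: P_def hull_subset)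

lemma constant_width_R: "constant_width 1 R"
  unfolding constant_width_def
proof (intro conjI allI impI)
  show "bounded R" using compact_R compact_imp_bounded by blast
  show "R \<noteq> {}" using bd_in_R by blast
  fix u :: complex assume "norm u = 1"
  then obtain s where s: "u = E s" using unit_eq_E by blast
  have "(SUP x\<in>R. u \<bullet> x) = E s \<bullet> bd s"
    unfolding s using R_support by (intro cSup_eq_maximum) auto
  moreover have "(INF x\<in>R. u \<bullet> x) = E s \<bullet> bd s - 1"
  proof (unfold s, intro cInf_eq_minimum)
    have "E s \<bullet> bd s - 1 = E s \<bullet> bd (s + of_int n)" by (simp add: bd_add_n inner_diff_right)
    then show "E s \<bullet> bd s - 1 \<in> (\<bullet>) (E s) ` R" by (metis bd_in_R image_eqI)
  qed (use R_support_opposite in auto)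
  ultimately show "(SUP x\<in>R. u \<bullet> x) - (INF x\<in>R. u \<bullet> x) = 1" by simp
qed

text \<open>Otherwise \<open>P\<close> lies on a line, whose normal is orthogonal to every
  difference \<open>vx j - vx (j + n) = E j\<close>. But \<open>E 0\<close> and \<open>E 1\<close>
  are linearly independent.\<close>

lemma interior_P: "interior P \<noteq> {}"
proof
  assume "interior P = {}"
  then obtain a c where a: "a \<noteq> 0" "P \<subseteq> {x. a \<bullet> x = c}"
    using empty_interior_subset_hyperplane[OF convex_P] by metis
  have *: "a \<bullet> E (of_int j) = 0" for j
  proof -
    have "a \<bullet> vx j = c" "a \<bullet> vx (j + n) = c" using a(2) vx_in_P by blast+
    then show ?thesis using vx_diff[of j] by (metis inner_diff_right diff_self)
  qed
  have "0 < pi / of_int n" "pi / of_int n < pi" using n_ge2 by (auto simp: field_simps)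
  then have "sin (pi / of_int n) > 0" by (rule sin_gt_zero)
  then show False
    using *[of 0] *[of 1] a(1) by (auto simp: E_def inner_complex_def complex_eq_iff)
qed

lemma interior_R: "interior R \<noteq> {}"
  using interior_P interior_mono[OF P_subset_R] by blast

text \<open>A frontier point has a supporting line with some outer normal \<open>E s\<close>, and
  the only point of contact in that direction is \<open>bd s\<close>. Conversely, any move from
  \<open>bd s\<close> along \<open>E s\<close> leaves \<open>R\<close>.\<close>

lemma frontier_R: "frontier R = range bd"
proof
  have cl: "closure R = R" using compact_R compact_imp_closed closure_closed by blast
  show "frontier R \<subseteq> range bd"
  proof
    fix x assume "x \<in> frontier R"
    then have x: "x \<in> R" "x \<notin> rel_interior R"
      by (auto simp: frontier_def cl rel_interior_nonempty_interior[OF interior_R])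
    then obtain a where a: "a \<noteq> 0" "\<And>y. y \<in> R \<Longrightarrow> a \<bullet> x \<le> a \<bullet> y"
      using supporting_hyperplane_relative_frontier[OF convex_R, of x] cl by metis
    obtain s where s: "- a /\<^sub>R norm a = E s"
      using unit_eq_E[of "- a /\<^sub>R norm a"] a(1) by auto
    have "E s \<bullet> y \<le> E s \<bullet> x" if "y \<in> R" for y
      unfolding s[symmetric] using a that by (simp add: divide_simps)
    then have "x = bd s" using x by (intro R_support_unique) auto
    then show "x \<in> range bd" by blast
  qed
  show "range bd \<subseteq> frontier R"
  proof
    fix x assume "x \<in> range bd"
    then obtain s where s: "x = bd s" by blast
    have "x \<notin> interior R"
    proof
      assume "x \<in> interior R"
      then obtain e where e: "e > 0" "cball x e \<subseteq> R" by (auto simp: mem_interior_cball)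
      then have "x + e *\<^sub>R E s \<in> R" by (intro subsetD[OF e(2)]) (auto simp: dist_norm)
      from R_support[OF this, of s] show False using e(1) by (simp add: s inner_add_right)
    qed
    then show "x \<in> frontier R" using s by (auto simp: frontier_def cl)
  qed
qed

section \<open>Coincidences of points on the curve\<close>

lemma bd_const:
  assumes "bd t = bd t'" "t \<le> r" "r \<le> t'" "t' \<le> t + of_int n"
  shows "bd r = bd t"
proof (rule R_support_unique)
  show "E t \<bullet> bd t \<le> E t \<bullet> bd r"
    using bd_antimono[of t r t'] assms by simp
qed simp

lemma E_neq_near:
  assumes "s < t" "t \<le> s + 1"
  shows "E s \<noteq> E t"
proof
  assume "E s = E t"
  then obtain k where k: "t = s + 2 * of_int n * of_int k" using E_eq_iff by blast
  then have "0 < 2 * real_of_int n * of_int k" "2 * real_of_int n * of_int k \<le> 1" using assms by auto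
  then have "0 < real_of_int k" using n_pos(3) by (metis mult_pos_pos zero_less_mult_pos zero_less_numeral)
  then have "1 \<le> real_of_int k" by simp
  then have "2 * real_of_int n * 1 \<le> 2 * real_of_int n * of_int k"
    using n_pos(3) by (intro mult_left_mono) linarith+
  moreover have "real_of_int n \<ge> 2" using n_ge2 by simp
  ultimately show False using \<open>2 * real_of_int n * of_int k \<le> 1\<close> by linarith
qed

text \<open>If the curve takes the same value twice within half a turn, it rests in between. A
  sector that shares an interval \<open>[r, r']\<close> of positive length with this range is
  therefore no arc sector.\<close>

lemma bd_eq_imp_not_b:
  assumes "bd t = bd t'" "t \<le> r" "r < r'" "r' \<le> t'" "t' \<le> t + of_int n"
    and "of_int j \<le> r" "r' \<le> of_int j + 1"
  shows "\<not> b j"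
proof
  assume "b j"
  have "bd r = bd t" "bd r' = bd t"
    using bd_const[of t t' r] bd_const[of t t' r'] assms(1-5) by linarith+
  then have "vx j + (E r - E (of_int j)) = vx j + (E r' - E (of_int j))"
    using bd_sector[of j r] bd_sector[of j r'] \<open>b j\<close> assms(3,6,7) by simp
  then have "E r = E r'" by simp
  then show False using E_neq_near[of r r'] assms by auto
qed

lemma vx_eq_imp_not_b:
  assumes "vx a = vx c" "a \<le> j" "j < c" "c \<le> a + n"
  shows "\<not> b j"
proof (rule bd_eq_imp_not_b[of "of_int a" "of_int c" "of_int j" "of_int j + 1"])
  show "real_of_int j + 1 \<le> of_int c" "real_of_int c \<le> of_int a + of_int n"
    using assms(3,4) by linarith+
qed (use assms in auto)

lemma vx_const:
  assumes "a \<le> c" "\<And>j. a \<le> j \<Longrightarrow> j < c \<Longrightarrow> \<not> b j"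
  shows "vx c = vx a"
  using assms
proof (induction c rule: int_ge_induct)
  case (step i)
  then show ?case using vx_Suc[of i] by simp
qed simp

text \<open>One of the two ways around from one index to the other is at most half a turn. Equal end
  points would make the curve rest along it, contradicting \<open>b\<close> at its first
  sector.\<close>

lemma vx_inj:
  assumes "vx a = vx c" "b a" "b c"
  shows "a mod (2*n) = c mod (2*n)"
proof (rule ccontr)
  assume neq: "a mod (2*n) \<noteq> c mod (2*n)"
  obtain c' where c': "c' mod (2*n) = c mod (2*n)" "a \<le> c'" "c' < a + 2*n"
    by (rule obtain_shift_int)
  have eq: "vx c' = vx a" "b c'" using assms vx_cong[OF c'(1)] b_cong[OF c'(1)] by auto
  have "a < c'" using c' neq by (cases "a = c'") auto
  show False
  proof (cases "c' \<le> a + n")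
    case True
    then show False using vx_eq_imp_not_b[of a c' a] eq assms \<open>a < c'\<close> by simp
  next
    case False
    then show False using vx_eq_imp_not_b[of c' "a + 2*n" c'] eq c' by simp
  qed
qed

text \<open>Advancing to the next arc sector, which antiperiodicity places at most \<open>n\<close>
  ahead, crosses vertex sectors only and so does not move the point.\<close>

lemma vx_eq_vx_b: "\<exists>k. b k \<and> vx k = vx j"
proof -
  define i where "i = (LEAST i::nat. b (j + int i))"
  have "b (j + int (nat n)) \<or> b (j + int 0)"
    using b_add_n[of j] n_ge2 by auto
  then have i: "b (j + int i)" unfolding i_def by (metis LeastI)
  have "\<not> b k" if "j \<le> k" "k < j + int i" for k
    using not_less_Least[of "nat (k - j)" "\<lambda>i. b (j + int i)"] that by (auto simp: i_def)
  then have "vx (j + int i) = vx j" by (intro vx_const) auto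
  then show ?thesis using i by blast
qed

lemma vx_eq_mod: "vx (j mod (2*n)) = vx j" "b (j mod (2*n)) = b j"
  by (rule vx_cong, simp) (rule b_cong, simp)

section \<open>Vertices of the inscribed polygon\<close>

lemma X_eq: "X = vx ` {j\<in>{0..<2*n}. b j}"
proof
  show "X \<subseteq> vx ` {j\<in>{0..<2*n}. b j}"
  proof
    fix y assume "y \<in> X"
    then obtain k where "b k" "vx k = y" using vx_eq_vx_b by (auto simp: X_def)
    then show "y \<in> vx ` {j\<in>{0..<2*n}. b j}"
      using vx_eq_mod[of k] by (intro image_eqI[of _ _ "k mod (2*n)"]) auto
  qed
qed (auto simp: X_def)

lemma finite_X: "finite X"
  unfolding X_eq by (intro finite_imageI finite_int_Collect)

text \<open>Exactly one of the sectors \<open>j\<close> and \<open>j + n\<close> is an arc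
  sector.\<close>

lemma card_ones: "card {j\<in>{0..<2*n}. b j} = nat n"
proof -
  have "{j\<in>{0..<2*n}. b j} = {j\<in>{0..<n}. b j} \<union> (\<lambda>j. j + n) ` {j\<in>{0..<n}. \<not> b j}"
  proof (intro equalityI subsetI)
    fix j assume j: "j \<in> {j\<in>{0..<2*n}. b j}"
    show "j \<in> {j\<in>{0..<n}. b j} \<union> (\<lambda>j. j + n) ` {j\<in>{0..<n}. \<not> b j}"
    proof (cases "j < n")
      case False
      then have "j - n \<in> {j\<in>{0..<n}. \<not> b j}" using j b_add_n[of "j - n"] by auto
      then show ?thesis by (intro UnI2 image_eqI[of _ _ "j - n"]) auto
    qed (use j in auto)
  qed (auto simp: b_add_n)
  moreover have "card ((\<lambda>j. j + n) ` {j\<in>{0..<n}. \<not> b j}) = card {j\<in>{0..<n}. \<not> b j}"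
    by (intro card_image) (auto simp: inj_on_def)
  moreover have "card {j\<in>{0..<n}. b j} + card {j\<in>{0..<n}. \<not> b j}
      = card ({j\<in>{0..<n}. b j} \<union> {j\<in>{0..<n}. \<not> b j})"
    by (intro card_Un_disjoint[symmetric] finite_int_Collect) auto
  moreover have "{j\<in>{0..<n}. b j} \<union> {j\<in>{0..<n}. \<not> b j} = {0..<n}" by blast
  moreover have "card ({j\<in>{0..<n}. b j} \<union> (\<lambda>j. j + n) ` {j\<in>{0..<n}. \<not> b j})
      = card {j\<in>{0..<n}. b j} + card ((\<lambda>j. j + n) ` {j\<in>{0..<n}. \<not> b j})"
    by (intro card_Un_disjoint finite_imageI finite_int_Collect) auto
  ultimately show ?thesis by simp
qed

lemma card_X: "card X = nat n"
proof -
  have "inj_on vx {j\<in>{0..<2*n}. b j}"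
  proof (rule inj_onI)
    fix j k assume "j \<in> {j\<in>{0..<2*n}. b j}" "k \<in> {j\<in>{0..<2*n}. b j}" "vx j = vx k"
    then show "j = k" using vx_inj[of j k] by simp
  qed
  then show ?thesis unfolding X_eq card_ones[symmetric] by (rule card_image)
qed

text \<open>Each \<open>vx j\<close> is exposed, being the only contact point of \<open>R\<close>
  with its supporting line normal to \<open>E j\<close>.\<close>

lemma vertices_P: "vertices P = X"
proof
  show "vertices P \<subseteq> X"
    unfolding vertices_def P_def by (rule extreme_points_of_convex_hull)
  show "X \<subseteq> vertices P"
  proof
    fix y assume "y \<in> X"
    then obtain j where j: "y = vx j" by (auto simp: X_def)
    have "P \<inter> {x. E (of_int j) \<bullet> x = E (of_int j) \<bullet> vx j} = {vx j}"
      using R_support_unique[of _ "of_int j"] P_subset_R by auto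
    then have "vx j extreme_point_of P"
      using R_support[of _ "of_int j"] P_subset_R
      by (intro extreme_point_of_Int_supporting_hyperplane_le) auto
    then show "y \<in> vertices P" by (simp add: vertices_def j)
  qed
qed

lemma polytope_P: "polytope P"
  by (simp add: P_def finite_X polytope_convex_hull finite_imp_compact finite_imp_bounded polytope_def) (metis finite_X)

lemma aff_dim_P: "aff_dim P = 2"
  using aff_dim_nonempty_interior[OF interior_P] by simp

lemma convex_ngon_P: "convex_ngon (nat n) P"
  by (simp add: convex_ngon_def polytope_P aff_dim_P vertices_P card_X)

section \<open>Edges of the inscribed polygon\<close>

lemma vx_strict:
  assumes "b i" "s \<le> of_int i" "of_int i + 1 \<le> s + of_int n"
  shows "E s \<bullet> vx (i + 1) < E s \<bullet> vx i"
  using cos_strict_aux[of s "of_int i" "of_int i + 1"] assms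
  by (simp add: vx_Suc inner_add_right inner_diff_right)

text \<open>In a direction within sector \<open>j\<close>, the height of the vertices falls off on
  both sides of the sector, strictly across each arc sector. A vertex \<open>vx k\<close> as high as
  both ends is thus separated from one of them by vertex sectors only.\<close>

lemma vx_max:
  assumes s: "of_int j \<le> s" "s \<le> of_int j + 1"
    and k: "E s \<bullet> vx j \<le> E s \<bullet> vx k" "E s \<bullet> vx (j + 1) \<le> E s \<bullet> vx k"
  shows "vx k \<in> {vx j, vx (j + 1)}"
proof -
  obtain l where l: "l mod (2*n) = k mod (2*n)" "j + 1 \<le> l" "l < j + 1 + 2 * n"
    by (rule obtain_shift_int)
  have vl: "vx l = vx k" using vx_cong[OF l(1)] .
  show ?thesis
  proof (cases "l \<le> j + n")
    case True
    have "\<not> b i" if i: "j + 1 \<le> i" "i < l" for i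
    proof
      assume "b i"
      have r: "real_of_int (j + 1) \<le> of_int i" "real_of_int (i + 1) \<le> of_int l"
        "real_of_int l \<le> of_int (j + n)"
        using i True by linarith+
      have "E s \<bullet> vx l \<le> E s \<bullet> vx (i + 1)"
        using bd_antimono[of s "of_int (i + 1)" "of_int l"] r s unfolding bd_int by linarith
      also have "\<dots> < E s \<bullet> vx i" using \<open>b i\<close> r s by (intro vx_strict) auto
      also have "\<dots> \<le> E s \<bullet> vx (j + 1)"
        using bd_antimono[of s "of_int (j + 1)" "of_int i"] r s unfolding bd_int by force
      finally show False using k vl by simp
    qed
    then have "vx l = vx (j + 1)" using l by (intro vx_const) auto
    then show ?thesis using vl by simp
  next
    case False
    define q where "q = l - 2 * n"
    have vq: "vx q = vx k" using vl vx_add_2n[of q] by (simp add: q_def)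
    have q: "q \<le> j" "j + 1 - n \<le> q" using l False by (auto simp: q_def)
    have "\<not> b i" if i: "q \<le> i" "i < j" for i
    proof
      assume "b i"
      have r: "real_of_int q \<le> of_int i" "real_of_int (i + 1) \<le> of_int j"
        "real_of_int (j + 1 - n) \<le> of_int q"
        using i q by linarith+
      have "E s \<bullet> vx q \<le> E s \<bullet> vx i"
        using bd_mono[of s "of_int q" "of_int i"] r s unfolding bd_int by force
      also have "\<dots> < E s \<bullet> vx (i + 1)" using vx_strict[of i "s - of_int n"] \<open>b i\<close> r s
        by (simp add: E_diff_n)
      also have "\<dots> \<le> E s \<bullet> vx j"
        using bd_mono[of s "of_int (i + 1)" "of_int j"] r s unfolding bd_int by force
      finally show False using k vq by simp
    qed
    then have "vx j = vx q" using q by (intro vx_const) auto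
    then show ?thesis using vq by simp
  qed
qed

lemma b_imp_vx_neq: "b j \<Longrightarrow> vx j \<noteq> vx (j + 1)"
  using E_neq_near[of "of_int j" "of_int j + 1"] by (simp add: vx_Suc)

text \<open>An edge is exposed, with outer normal \<open>E s\<close> say. If \<open>s\<close> lies
  in sector \<open>j\<close>, then by \<open>vx_max\<close> only \<open>vx j\<close> and
  \<open>vx (j + 1)\<close> can span the edge.\<close>

lemma edge_imp:
  assumes "e edge_of P"
  shows "\<exists>j. b j \<and> e = closed_segment (vx j) (vx (j + 1))"
proof -
  have f: "e face_of P" and d: "aff_dim e = 1" using assms by (auto simp: edge_of_def)
  have "e exposed_face_of P"
    using f polytope_P by (simp add: exposed_face_of_polyhedron polytope_imp_polyhedron)
  then obtain a c where a: "a \<noteq> 0" "P \<subseteq> {x. a \<bullet> x \<le> c}" "e = P \<inter> {x. a \<bullet> x = c}"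
    using d aff_dim_P unfolding exposed_face_of by auto
  obtain s where s: "a /\<^sub>R norm a = E s"
    using unit_eq_E[of "a /\<^sub>R norm a"] a(1) by auto
  have max: "E s \<bullet> y \<le> E s \<bullet> x" if "y \<in> P" "x \<in> e" for x y
  proof -
    have "a \<bullet> y \<le> a \<bullet> x" using a that by auto
    then show ?thesis unfolding s[symmetric] using a(1) by (simp add: divide_simps)
  qed
  define j where "j = \<lfloor>s\<rfloor>"
  have js: "of_int j \<le> s" "s \<le> of_int j + 1" unfolding j_def by linarith+
  obtain Y where Y: "Y \<subseteq> X" "e = convex hull Y"
    using face_of_convex_hull_subset[of X e] f finite_X by (auto simp: P_def finite_imp_compact)
  have sub: "Y \<subseteq> {vx j, vx (j + 1)}"
  proof
    fix y assume y: "y \<in> Y"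
    then obtain k where k: "y = vx k" using Y by (auto simp: X_def)
    have "y \<in> e" using y Y by (simp add: hull_inc)
    then show "y \<in> {vx j, vx (j + 1)}" unfolding k using max by (intro vx_max[OF js]) (auto simp: k)
  qed
  have dY: "aff_dim Y = 1" using d Y by (simp add: aff_dim_convex_hull)
  note Y2 = aff_dim_subset_doubleton[OF sub dY]
  then have "b j" using vx_Suc[of j] by (cases "b j") auto
  moreover have "e = closed_segment (vx j) (vx (j + 1))" using Y Y2 by (simp add: segment_convex_hull)
  ultimately show ?thesis by blast
qed

lemma edge_if:
  assumes "b j"
  shows "closed_segment (vx j) (vx (j + 1)) edge_of P"
proof -
  \<comment> \<open>The middle direction of a sector is normal to its chord, so both ends have the
    same height.\<close>
  define s where "s = of_int j + (1/2 :: real)"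
  have js: "of_int j \<le> s" "s \<le> of_int j + 1" by (auto simp: s_def)
  have "E s \<bullet> E (of_int j) = E s \<bullet> E (of_int j + 1)"
    by (simp add: inner_E s_def)
  then have eq: "E s \<bullet> vx (j + 1) = E s \<bullet> vx j"
    by (simp add: vx_Suc inner_add_right inner_diff_right)
  have le: "E s \<bullet> vx k \<le> E s \<bullet> vx j" for k
    using vx_max[OF js, of k] eq by fastforce
  have "P \<subseteq> {x. E s \<bullet> x \<le> E s \<bullet> vx j}"
    unfolding P_def by (intro hull_minimal convex_halfspace_le) (auto simp: X_def le)
  then have f: "(P \<inter> {x. E s \<bullet> x = E s \<bullet> vx j}) face_of P" (is "?F face_of P")
    by (intro face_of_Int_supporting_hyperplane_le convex_P) auto
  then obtain Y where Y: "Y \<subseteq> X" "?F = convex hull Y"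
    using face_of_convex_hull_subset[of X ?F] finite_X by (auto simp: P_def finite_imp_compact)
  have "Y \<subseteq> {vx j, vx (j + 1)}"
  proof
    fix y assume y: "y \<in> Y"
    then obtain k where k: "y = vx k" using Y by (auto simp: X_def)
    have "y \<in> ?F" using y Y by (simp add: hull_inc)
    then show "y \<in> {vx j, vx (j + 1)}" unfolding k using eq by (intro vx_max[OF js]) auto
  qed
  then have "?F \<subseteq> convex hull {vx j, vx (j + 1)}" using Y by (simp add: hull_mono)
  moreover have "convex hull {vx j, vx (j + 1)} \<subseteq> ?F"
    using f face_of_imp_convex eq by (intro hull_minimal) auto
  ultimately have "?F = closed_segment (vx j) (vx (j + 1))" by (simp add: segment_convex_hull)
  then show ?thesis
    using f b_imp_vx_neq[OF assms] by (simp add: edge_of_def segment_convex_hull aff_dim_convex_hull)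
qed

lemma equilateral_P: "equilateral P"
  unfolding equilateral_def
proof (intro exI allI impI)
  fix e assume "e edge_of P"
  then obtain j where j: "b j" "e = closed_segment (vx j) (vx (j + 1))" using edge_imp by blast
  have "vx (j + 1) - vx j = E (of_int j) * (E 1 - 1)"
    using j(1) unfolding vx_Suc by (simp add: E_add algebra_simps)
  then have "dist (vx j) (vx (j + 1)) = norm (E 1 - 1)"
    by (simp add: dist_norm norm_minus_commute[of "vx j"] norm_mult)
  then show "diameter e = norm (E 1 - 1)"
    by (simp add: j(2) diameter_closed_segment)
qed

section \<open>Points at distance 1\<close>

lemma dist_1_imp_bd:
  assumes "y \<in> R" "z \<in> R" "dist y z = 1"
  shows "\<exists>s. y = bd s \<and> z = bd (s + of_int n)"
proof -
  obtain s where s: "y - z = E s" using unit_eq_E[of "y - z"] assms by (auto simp: dist_norm)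
  have "E s \<bullet> y - E s \<bullet> z = 1" by (simp add: s flip: inner_diff_right)
  then have "E s \<bullet> bd s \<le> E s \<bullet> y" "E s \<bullet> bd s - 1 \<ge> E s \<bullet> z"
    using R_support_opposite[of z s] R_support[of y s] assms by linarith+
  then have "y = bd s" using assms by (intro R_support_unique)
  then show ?thesis using s by (metis bd_add_n diff_diff_eq2 add_diff_cancel_left')
qed

text \<open>Some index \<open>k\<close> of the vertex lies within half a turn of \<open>s\<close>,
  after it or before it. The curve rests from one to the other, hence on part of sector
  \<open>j\<close>.\<close>

lemma bd_in_X_imp:
  assumes "bd s \<in> X" "of_int j < s" "s < of_int j + 1"
  shows "\<not> b j"
proof -
  obtain l where l: "bd s = vx l" using assms by (auto simp: X_def)
  obtain k where k: "k mod (2*n) = l mod (2*n)" "j + 1 \<le> k" "k < j + 1 + 2 * n"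
    by (rule obtain_shift_int)
  have kl: "vx k = bd s" using l vx_cong[OF k(1)] by simp
  show ?thesis
  proof (cases "k \<le> j + n")
    case True
    then have "real_of_int (j + 1) \<le> of_int k" "real_of_int k \<le> of_int (j + n)"
      using k by linarith+
    then show ?thesis
      using assms kl by (intro bd_eq_imp_not_b[of s "of_int k" s "of_int (j + 1)"]) auto
  next
    case False
    define q where "q = k - 2 * n"
    have "vx q = bd s" using kl vx_add_2n[of q] by (simp add: q_def)
    moreover have "real_of_int q \<le> of_int j" "real_of_int (j + 1) \<le> of_int (q + n)"
      using k False by (simp_all add: q_def del: of_int_add of_int_diff)
    ultimately show ?thesis
      using assms by (intro bd_eq_imp_not_b[of "of_int q" s "of_int j" s]) auto
  qed
qed

text \<open>The two points have opposite outer normals. If these lay strictly inside sectors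
  \<open>j\<close> and \<open>j + n\<close>, neither would be an arc sector, contradicting
  antiperiodicity.\<close>

lemma dist_1_X:
  assumes "y \<in> X" "z \<in> X" "dist y z = 1"
  shows "\<exists>a. y = vx a \<and> z = vx (a + n)"
proof -
  obtain s where s: "y = bd s" "z = bd (s + of_int n)"
    using dist_1_imp_bd assms X_subset_R by blast
  define j where "j = \<lfloor>s\<rfloor>"
  have js: "of_int j \<le> s" "s < of_int j + 1" unfolding j_def by linarith+
  show ?thesis
  proof (cases "s = of_int j")
    case True
    then have "s + of_int n = of_int (j + n)" by simp
    then show ?thesis using s True by (metis bd_int)
  next
    case False
    then have "\<not> b j" "\<not> b (j + n)"
      using bd_in_X_imp[of s j] bd_in_X_imp[of "s + of_int n" "j + n"] js s assms by auto
    then show ?thesis by (simp add: b_add_n)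
  qed
qed

lemma dist_vx_n: "dist (vx a) (vx (a + n)) = 1"
  using vx_diff[of a] by (simp add: dist_norm)

text \<open>The circles of radius 1 about the ends of a chord meet in \<open>vx (j + n)\<close> and in its mirror
  image, which lies beyond the supporting line parallel to the chord.\<close>

lemma both_dist_1:
  assumes v: "v \<in> R" and "b j" and d: "dist v (vx j) = 1" "dist v (vx (j + 1)) = 1"
  shows "v = vx (j + n)"
proof -
  define \<alpha> where "\<alpha> = pi / (2 * of_int n)"
  define s where "s = of_int j + (1/2 :: real)"
  \<comment> \<open>In these coordinates \<open>vx (j + n)\<close> is the origin, the real axis
    bisects the sector, and the ends of the chord are \<open>cis (- \<alpha>)\<close> and
    \<open>cis \<alpha>\<close>.\<close>
  define w where "w = (v - vx (j + n)) * cnj (E s)"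
  have "\<alpha> > 0" by (simp add: \<alpha>_def)
  have "\<alpha> < pi / 3"
    using n_ge2 by (simp add: \<alpha>_def field_simps)
  have sc: "sin \<alpha> > 0" "cos \<alpha> > 1/2"
    using \<open>\<alpha> > 0\<close> \<open>\<alpha> < pi / 3\<close> cos_monotone_0_pi[of \<alpha> "pi/3"] by (auto intro!: sin_gt_zero simp: cos_60)
  have EE: "E s * cnj (E s) = 1" by (simp add: complex_norm_square[symmetric])
  have e0: "E (of_int j) * cnj (E s) = cis (- \<alpha>)" and e1: "E (of_int j + 1) * cnj (E s) = cis \<alpha>"
    by (simp_all add: E_def cis_cnj cis_mult s_def \<alpha>_def field_simps)
  have vj: "vx j = vx (j + n) + E (of_int j)" by (simp add: vx_add_n)
  have vj1: "vx (j + 1) = vx (j + n) + E (of_int j + 1)" using \<open>b j\<close> by (simp add: vx_Suc vx_add_n)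
  have "norm (w - cis (- \<alpha>)) = dist v (vx j)"
  proof -
    have "w - cis (- \<alpha>) = (v - vx j) * cnj (E s)" by (simp add: w_def vj algebra_simps flip: e0)
    then show ?thesis by (simp add: norm_mult dist_norm)
  qed
  moreover have "norm (w - cis \<alpha>) = dist v (vx (j + 1))"
  proof -
    have "w - cis \<alpha> = (v - vx (j + 1)) * cnj (E s)"
      unfolding w_def vj1 e1[symmetric] by (simp add: algebra_simps)
    then show ?thesis by (simp add: norm_mult dist_norm)
  qed
  ultimately have "(Re w - cos \<alpha>)\<^sup>2 + (Im w + sin \<alpha>)\<^sup>2 = 1" "(Re w - cos \<alpha>)\<^sup>2 + (Im w - sin \<alpha>)\<^sup>2 = 1"
    using d by (simp_all add: cmod_def)
  then have "4 * (Im w * sin \<alpha>) = 0" and q: "(Re w - cos \<alpha>)\<^sup>2 + (Im w + sin \<alpha>)\<^sup>2 = 1"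
    unfolding power2_sum power2_diff by linarith+
  then have im: "Im w = 0" using sc by auto
  then have "Re w * (Re w - 2 * cos \<alpha>) = 0"
    using q sin_cos_squared_add[of \<alpha>] by (simp add: power2_eq_square algebra_simps)
  \<comment> \<open>This excludes the mirror image \<open>2 * cos \<alpha>\<close>, which exceeds 1
    because \<open>\<alpha> < pi / 3\<close>.\<close>
  moreover have "Re w \<le> 1"
  proof -
    have "bd s = vx (j + n) + E s"
      using bd_sector[of j s] \<open>b j\<close> vj by (simp add: s_def)
    then have "E s \<bullet> (v - vx (j + n)) \<le> 1"
      using R_support[OF v, of s] by (simp add: inner_add_right inner_diff_right)
    then show ?thesis by (simp add: w_def inner_complex_def algebra_simps)
  qed
  ultimately have "Re w = 0" using sc by auto
  then have "w = 0" using im by (simp add: complex_eq_iff)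
  then show ?thesis by (simp add: w_def)
qed


subsection \<open>Runs of the word\<close>

text \<open>The index of the run containing sector \<open>j\<close>: the number of sign changes in \<open>(0, j]\<close>, counted
  negatively for \<open>j < 0\<close>.\<close>

definition idx :: "int \<Rightarrow> int" where
  "idx j = (\<Sum>i\<in>{1..j}. of_bool (b i \<noteq> b (i - 1))) - (\<Sum>i\<in>{j+1..0}. of_bool (b i \<noteq> b (i - 1)))"

text \<open>The number of runs in half a period. It becomes the number of vertices of the Reuleaux
  polygon and the length of the composition.\<close>

definition m :: int where
  "m = idx n"

text \<open>The first sector of run \<open>i\<close>, characterised as the lower adjoint of \<open>idx\<close>.\<close>

definition st :: "int \<Rightarrow> int" where
  "st i = (SOME s. \<forall>j. s \<le> j \<longleftrightarrow> i \<le> idx j)"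

lemma idx_0 [simp]: "idx 0 = 0"
  by (simp add: idx_def)

lemma idx_Suc: "idx (j + 1) = idx j + of_bool (b (j + 1) \<noteq> b j)"
proof (cases "j \<ge> 0")
  case True
  then have "{1..j+1} = insert (j+1) {1..j}" by auto
  then show ?thesis using True by (simp add: idx_def)
next
  case False
  then have "{j+1..0} = insert (j+1) {j+1+1..0}" by auto
  then show ?thesis using False by (simp add: idx_def)
qed

text \<open>Negating both neighbours keeps a sign change, so the sign changes have period
  \<open>n\<close>.\<close>

lemma idx_add_n: "idx (j + n) = idx j + m"
proof -
  define D where "D j = idx (j + n) - idx j" for j
  have "D (j + 1) = D j" for j
    using idx_Suc[of j] idx_Suc[of "j + n"] b_add_n[of j] b_add_n[of "j + 1"]
    by (simp add: D_def algebra_simps)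
  then have "D (0 + j) = D 0"
    using periodic_int_mult[where f=D and c=1 and j=0 and k=j] by simp
  then show ?thesis by (simp add: D_def m_def)
qed

lemma idx_add_nk: "idx (j + n * k) = idx j + m * k"
proof -
  have "idx (j + n * k) - m * k = idx j"
  proof (induction k rule: int_induct[of _ 0])
    case (step1 i)
    then show ?case using idx_add_n[of "j + n * i"] by (simp add: algebra_simps)
  next
    case (step2 i)
    then show ?case using idx_add_n[of "j + n * (i - 1)"] by (simp add: algebra_simps)
  qed simp
  then show ?thesis by simp
qed

lemma idx_cong: "j mod (2*n) = k mod (2*n) \<Longrightarrow> idx j mod (2*m) = idx k mod (2*m)"
proof -
  have "idx (j mod (2*n)) mod (2*m) = idx j mod (2*m)" for j
  proof -
    have "idx j = idx (j mod (2*n) + n * (2 * (j div (2*n))))"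
      by (metis mod_mult_div_eq mult.assoc mult.commute)
    also have "\<dots> = idx (j mod (2*n)) + (2*m) * (j div (2*n))"
      unfolding idx_add_nk by simp
    finally show ?thesis by simp
  qed
  then show "j mod (2*n) = k mod (2*n) \<Longrightarrow> idx j mod (2*m) = idx k mod (2*m)" by metis
qed

text \<open>Run 0 contains sector 0, where \<open>b\<close> holds, and \<open>b\<close> alternates
  from run to run.\<close>

lemma even_idx: "even (idx j) \<longleftrightarrow> b j"
proof (induction j rule: int_induct[of _ 0])
  case base
  then show ?case by (simp add: b_0)
next
  case (step1 i)
  then show ?case using idx_Suc[of i] by auto
next
  case (step2 i)
  then show ?case using idx_Suc[of "i - 1"] by (cases "b i"; cases "b (i - 1)") auto
qed

lemma idx_mono: "j \<le> k \<Longrightarrow> idx j \<le> idx k"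
proof (induction k rule: int_ge_induct)
  case (step i)
  then show ?case using idx_Suc[of i] by auto
qed simp

lemma odd_m: "odd m"
  using even_idx[of n] b_add_n[of 0] b_0 by (simp add: m_def)

lemma m_pos: "m > 0"
  using idx_mono[of 0 n] odd_m by (cases "m = 0") (auto simp: m_def)

text \<open>The threshold exists because \<open>idx\<close> is monotone and, gaining
  \<open>m > 0\<close> per shift by \<open>n\<close>, unbounded in both directions;
  \<open>j0\<close> is a sector certainly below it.\<close>

lemma st_le_iff: "st i \<le> j \<longleftrightarrow> i \<le> idx j"
proof -
  define j0 where "j0 = n * (- \<bar>i\<bar> - 1)"
  have "idx j0 = m * (- \<bar>i\<bar> - 1)" using idx_add_nk[of 0] by (simp add: j0_def)
  also have "\<dots> \<le> 1 * (- \<bar>i\<bar> - 1)" using m_pos by (intro mult_right_mono_neg) auto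
  finally have j0: "idx j0 < i" by simp
  define k where "k = (LEAST k::nat. i \<le> idx (j0 + int k))"
  have "i \<le> m * (\<bar>i\<bar>)" using m_pos mult_right_mono[of 1 m "\<bar>i\<bar>"] by simp
  then have "i \<le> idx (j0 + int (nat (n * (2 * \<bar>i\<bar> + 1))))"
    using idx_add_nk[of j0 "2 * \<bar>i\<bar> + 1"] idx_add_nk[of 0 "- \<bar>i\<bar> - 1"]
    by (simp add: j0_def algebra_simps)
  then have k: "i \<le> idx (j0 + int k)" unfolding k_def by (rule LeastI)
  have "\<forall>j. j0 + int k \<le> j \<longleftrightarrow> i \<le> idx j"
  proof (intro allI iffI)
    fix j assume "j0 + int k \<le> j"
    then show "i \<le> idx j" using idx_mono k order_trans by blast
  next
    fix j assume j: "i \<le> idx j"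
    then have "j0 \<le> j" using idx_mono[of j j0] j0 by linarith
    then have "k \<le> nat (j - j0)" using j unfolding k_def by (intro Least_le) simp
    then show "j0 + int k \<le> j" using \<open>j0 \<le> j\<close> by linarith
  qed
  then have "\<forall>j. st i \<le> j \<longleftrightarrow> i \<le> idx j" unfolding st_def by (rule someI)
  then show ?thesis by blast
qed

lemma idx_st [simp]: "idx (st i) = i"
proof -
  have "i \<le> idx (st i)" using st_le_iff[of i "st i"] by simp
  moreover have "idx (st i - 1) < i" using st_le_iff[of i "st i - 1"] by simp
  moreover have "idx (st i) \<le> idx (st i - 1) + 1" using idx_Suc[of "st i - 1"] by simp
  ultimately show ?thesis by linarith
qed

lemma st_less_iff [simp]: "st i < st k \<longleftrightarrow> i < k"
  using st_le_iff[of k "st i"] by (simp add: not_le flip: not_le)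

lemma st_le_st [simp]: "st i \<le> st k \<longleftrightarrow> i \<le> k"
  using st_le_iff[of i "st k"] by simp

lemma idx_eq_iff: "idx j = i \<longleftrightarrow> st i \<le> j \<and> j < st (i + 1)"
  using st_le_iff[of i j] st_le_iff[of "i + 1" j] by linarith

lemma st_add_mk: "st (i + m * k) = st i + n * k"
proof (rule antisym)
  show "st (i + m * k) \<le> st i + n * k" by (simp add: st_le_iff idx_add_nk)
  have "i \<le> idx (st (i + m * k) + n * (- k))" unfolding idx_add_nk by simp
  then show "st i + n * k \<le> st (i + m * k)" unfolding st_le_iff[symmetric] by simp
qed

lemma vx_run:
  assumes "odd q" "st q \<le> j" "j \<le> st (q + 1)"
  shows "vx j = vx (st q)"
proof (rule vx_const)
  fix i assume "st q \<le> i" "i < j"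
  then have "idx i = q" using assms by (simp add: idx_eq_iff)
  then show "\<not> b i" using assms(1) even_idx by blast
qed fact

text \<open>With a single run per half period, a vertex run would span half a turn and identify two
  antipodal points, which have distance 1.\<close>

lemma m_ge3: "m \<ge> 3"
proof -
  have "m \<noteq> 1"
  proof
    assume "m = 1"
    then have "vx (st 0 + 2 * n) = vx (st 0 + n)"
      using vx_run[of 1 "st 0 + 2*n"] st_add_mk[of 0 1] st_add_mk[of 0 2] by simp
    then show False using dist_vx_n[of "st 0"] by simp
  qed
  moreover have "m \<noteq> 2" using odd_m by auto
  ultimately show ?thesis using m_pos by linarith
qed

text \<open>The antipodes of an arc run form a vertex run, so all its sectors share one
  centre.\<close>

lemma bd_arc:
  assumes "of_int (st (2*k)) \<le> t" "t \<le> of_int (st (2*k+1))"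
  shows "bd t = vx (st (2*k) + n) + E t"
proof -
  \<comment> \<open>The right end of the run is assigned to its last sector, since its floor belongs
    to the next run.\<close>
  define j where "j = (if t = of_int (st (2*k+1)) then st (2*k+1) - 1 else \<lfloor>t\<rfloor>)"
  have j: "of_int j \<le> t" "t \<le> of_int j + 1" unfolding j_def by auto
  have "st (2*k) < st (2*k+1)" by simp
  then have "st (2*k) \<le> j" "j < st (2*k+1)"
    using assms by (auto simp: j_def le_floor_iff floor_less_iff)
  then have "idx j = 2*k" by (simp add: idx_eq_iff)
  then have "b j" using even_idx[of j] by simp
  have "vx (j + n) = vx (st (2*k) + n)"
  proof (rule vx_const)
    fix i assume "st (2*k) + n \<le> i" "i < j + n"
    then have "idx (i - n) = 2*k" using \<open>j < st (2*k+1)\<close> by (simp add: idx_eq_iff)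
    then have "b (i - n)" using even_idx[of "i - n"] by simp
    then show "\<not> b i" using b_add_n[of "i - n"] by simp
  qed (use \<open>st (2*k) \<le> j\<close> in simp)
  then show ?thesis using bd_sector[OF j] \<open>b j\<close> by (simp add: vx_add_n)
qed

subsection \<open>The Reuleaux polygon\<close>

definition arc :: "int \<Rightarrow> real \<Rightarrow> complex" where
  "arc k = part_circlepath (vx (st (2*k) + n)) 1 (pi * of_int (st (2*k)) / of_int n)
     (pi * of_int (st (2*k+1)) / of_int n)"

lemma arc_ends: "pathstart (arc k) = vx (st (2*k))" "pathfinish (arc k) = vx (st (2*k+1))"
  using bd_arc[of k "of_int (st (2*k))"] bd_arc[of k "of_int (st (2*k+1))"]
  by (simp_all add: arc_def E_def cis_conv_exp)

lemma arc_angles: "pi * of_int (st (2*k)) / of_int n < pi * of_int (st (2*k+1)) / of_int n"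
  "pi * of_int (st (2*k+1)) / of_int n < pi * of_int (st (2*k)) / of_int n + 2 * pi"
proof -
  show "pi * of_int (st (2*k)) / of_int n < pi * of_int (st (2*k+1)) / of_int n"
    by (intro divide_strict_right_mono mult_strict_left_mono) auto
  have "st (2*k+1) < st (2*k + m * 2)" using m_ge3 by (simp del: st_le_st)
  then have "st (2*k+1) < st (2*k) + 2 * n" unfolding st_add_mk by simp
  then have "real_of_int (st (2*k+1)) < of_int (st (2*k) + 2 * n)" by (simp only: of_int_less_iff)
  then have "pi * of_int (st (2*k+1)) < pi * (of_int (st (2*k)) + 2 * of_int n)"
    by (intro mult_strict_left_mono) auto
  then show "pi * of_int (st (2*k+1)) / of_int n < pi * of_int (st (2*k)) / of_int n + 2 * pi"
    by (simp add: field_simps)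
qed

lemma path_image_arc: "path_image (arc k) = bd ` {of_int (st (2*k))..of_int (st (2*k+1))}"
proof -
  let ?I = "{of_int (st (2*k))..real_of_int (st (2*k+1))}"
  have "closed_segment (pi * of_int (st (2*k)) / of_int n) (pi * of_int (st (2*k+1)) / of_int n)
     = (\<lambda>t. pi * t / of_int n) ` ?I"
  proof -
    have eq: "(\<lambda>t. pi * t / of_int n) = (*) (pi / of_int n)" by auto
    have "pi / of_int n > 0" by simp
    then show ?thesis
      unfolding eq image_mult_atLeastAtMost[OF \<open>pi / of_int n > 0\<close>]
      using arc_angles(1)[of k] by (simp add: closed_segment_eq_real_ivl)
  qed
  then have "path_image (arc k) = (\<lambda>t. vx (st (2*k) + n) + E t) ` ?I"
    unfolding arc_def path_image_part_circlepath' by (simp add: image_image E_def)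
  also have "\<dots> = bd ` ?I" using bd_arc by (intro image_cong) auto
  finally show ?thesis .
qed

text \<open>A vertex run contributes only the final point of the arc before it, so the
  \<open>m\<close> arc runs of a full turn cover the curve.\<close>

lemma range_bd_eq: "range bd = (\<Union>k\<in>{0..<m}. path_image (arc k))"
proof (intro equalityI subsetI)
  fix y assume "y \<in> range bd"
  then obtain t0 where t0: "y = bd t0" by blast
  obtain l where l: "of_int (st 0) \<le> t0 + 2 * of_int n * of_int l"
    "t0 + 2 * of_int n * of_int l < of_int (st 0) + 2 * of_int n"
    by (rule obtain_shift)
  define t where "t = t0 + 2 * of_int n * of_int l"
  have y: "y = bd t" by (simp add: t0 t_def bd_add_2nk)
  define j where "j = \<lfloor>t\<rfloor>"
  have jt: "of_int j \<le> t" "t < of_int j + 1" unfolding j_def by linarith+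
  have "st 0 \<le> j" "j < st 0 + 2 * n" using l by (auto simp: j_def le_floor_iff floor_less_iff simp flip: t_def)
  then have q: "0 \<le> idx j" "idx j < 2 * m"
    using st_le_iff[of 0 j] st_le_iff[of "2*m" j] st_add_mk[of 0 2] by (auto simp: mult.commute)
  have run: "st (idx j) \<le> j" "j + 1 \<le> st (idx j + 1)" using idx_eq_iff[of j "idx j"] by auto
  have "of_int (j + 1) \<le> real_of_int (st (idx j + 1))" using run(2) by (simp only: of_int_le_iff)
  then have run': "of_int (st (idx j)) \<le> t" "t \<le> of_int (st (idx j + 1))"
    using jt run(1) by (auto intro: order_trans[of _ "of_int j"])
  show "y \<in> (\<Union>k\<in>{0..<m}. path_image (arc k))"
  proof (cases "even (idx j)")
    case True
    then obtain k where k: "idx j = 2*k" by blast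
    then have "k \<in> {0..<m}" using q by auto
    moreover have "y \<in> path_image (arc k)" unfolding path_image_arc y using run' k by auto
    ultimately show ?thesis by blast
  next
    case False
    then obtain k where k: "idx j = 2*k+1" by (rule oddE)
    then have "k \<in> {0..<m}" using q by auto
    have "\<not> b j" using False even_idx by blast
    then have "y = vx j" using bd_sector[of j t] jt y by simp
    also have "\<dots> = pathfinish (arc k)" using vx_run[of "idx j" j] False run by (simp add: arc_ends k)
    finally have "y \<in> path_image (arc k)" by (simp only: pathfinish_in_path_image)
    then show ?thesis using \<open>k \<in> {0..<m}\<close> by blast
  qed
qed (auto simp: path_image_arc)

text \<open>The curve rests between the two parameters, so no part of the first arc can lie ahead of
  \<open>t\<close> and no part of the second behind \<open>t'\<close>.\<close>

lemma arcs_meet_aux: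
  assumes "bd t = bd t'" "k < k'" "t' \<le> t + of_int n"
    and t: "of_int (st (2*k)) \<le> t" "t \<le> of_int (st (2*k+1))"
    and t': "of_int (st (2*k')) \<le> t'" "t' \<le> of_int (st (2*k'+1))"
  shows "t = of_int (st (2*k+1)) \<and> t' = of_int (st (2*k'))"
proof (intro conjI; rule ccontr)
  have "st (2*k+1) < st (2*k')" using assms(2) by simp
  then have gap: "real_of_int (st (2*k+1)) < of_int (st (2*k'))" by (simp only: of_int_less_iff)
  {
    assume "t \<noteq> of_int (st (2*k+1))"
    define j where "j = \<lfloor>t\<rfloor>"
    have jt: "of_int j \<le> t" "t < of_int j + 1" unfolding j_def by linarith+
    have "st (2*k) \<le> j" "j < st (2*k+1)"
      using t \<open>t \<noteq> _\<close> by (auto simp: j_def le_floor_iff floor_less_iff)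
    then have "idx j = 2*k" by (simp add: idx_eq_iff)
    then have "b j" using even_idx[of j] by simp
    moreover have "\<not> b j"
    proof (rule bd_eq_imp_not_b[of t t' t "of_int j + 1"])
      have "real_of_int (j + 1) \<le> of_int (st (2*k+1))"
        using \<open>j < st (2*k+1)\<close> by (simp only: of_int_le_iff)
      then show "of_int j + 1 \<le> t'" using gap t' by linarith
    qed (use assms jt in auto)
    ultimately show False by blast
  }
  {
    assume "t' \<noteq> of_int (st (2*k'))"
    \<comment> \<open>The sector to the left of \<open>t'\<close> is wanted, hence the
      ceiling.\<close>
    define j where "j = \<lceil>t'\<rceil> - 1"
    have jt: "of_int j < t'" "t' \<le> of_int j + 1" unfolding j_def by linarith+
    have j: "st (2*k') \<le> j" "j < st (2*k'+1)"
      using t' \<open>t' \<noteq> _\<close> unfolding j_def by linarith+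
    then have "idx j = 2*k'" by (simp add: idx_eq_iff)
    then have "b j" using even_idx[of j] by simp
    moreover have "\<not> b j"
    proof (rule bd_eq_imp_not_b[of t t' "of_int j" t'])
      have "real_of_int (st (2*k')) \<le> of_int j" using j by simp
      then show "t \<le> of_int j" using gap t by linarith
    qed (use assms jt in auto)
    ultimately show False by blast
  }
qed

lemma arcs_meet:
  assumes "0 \<le> k" "k < k'" "k' < m" "y \<in> path_image (arc k)" "y \<in> path_image (arc k')"
  shows "(y = pathfinish (arc k) \<and> y = pathstart (arc k')) \<or>
         (y = pathstart (arc k) \<and> y = pathfinish (arc k'))"
proof -
  obtain t t' where t: "of_int (st (2*k)) \<le> t" "t \<le> of_int (st (2*k+1))" "y = bd t"
    and t': "of_int (st (2*k')) \<le> t'" "t' \<le> of_int (st (2*k'+1))" "y = bd t'"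
    using assms(4,5) by (auto simp: path_image_arc)
  show ?thesis
  proof (cases "t' \<le> t + of_int n")
    case True
    then show ?thesis using arcs_meet_aux[of t t' k k'] t t' assms by (auto simp: arc_ends)
  next
    case False
    \<comment> \<open>If \<open>k'\<close> is more than half a turn ahead of \<open>k\<close>, then
      \<open>k\<close>, taken one turn later as \<open>k + m\<close>, follows \<open>k'\<close>
      within half a turn.\<close>
    have s: "st (2 * (k + m)) = st (2*k) + 2 * n" "st (2 * (k + m) + 1) = st (2*k+1) + 2 * n"
      using st_add_mk[of "2*k" 2] st_add_mk[of "2*k+1" 2] by (simp_all add: algebra_simps)
    have "t' = of_int (st (2*k'+1)) \<and> t + 2 * of_int n = of_int (st (2 * (k + m)))"
    proof (rule arcs_meet_aux)
      show "bd t' = bd (t + 2 * of_int n)" using t t' by (simp add: bd_add_2n)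
      show "k' < k + m" "t + 2 * of_int n \<le> t' + of_int n" using assms False by simp_all
      show "of_int (st (2 * (k + m))) \<le> t + 2 * of_int n" "t + 2 * of_int n \<le> of_int (st (2 * (k + m) + 1))"
        unfolding s using t by simp_all
    qed fact+
    then have "t' = of_int (st (2*k'+1))" "t = of_int (st (2*k))" unfolding s by simp_all
    then show ?thesis using t t' by (simp add: arc_ends)
  qed
qed

lemma vx_st_next: "vx (st (2*k+1)) = vx (st (2*k+2))"
  using vx_run[of "2*k+1" "st (2*k+2)"] by simp

text \<open>The vertex run between two consecutive arcs has an arc run as its antipode, and along it
  the curve moves from one centre to the other.\<close>

lemma arc_centres_neq: "vx (st (2*k) + n) \<noteq> vx (st (2*(k+1)) + n)"
proof
  assume eq: "vx (st (2*k) + n) = vx (st (2*(k+1)) + n)"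
  have "st (2*(k+1)) \<le> st (2*k + m * 1)" using m_ge3 by (simp del: mult_1_right)
  then have "st (2*(k+1)) \<le> st (2*k) + n" unfolding st_add_mk by simp
  then have "\<not> b (st (2*k+1) + n)"
    by (intro vx_eq_imp_not_b[OF eq]) auto
  then show False using b_add_n even_idx[of "st (2*k+1)"] by auto
qed

definition V :: "complex set" where
  "V = {vx j | j. \<not> b j}"

lemma V_eq: "V = (\<lambda>k. pathstart (arc k)) ` {0..<m}"
proof (intro equalityI subsetI)
  fix v assume "v \<in> V"
  then obtain j0 where j0: "v = vx j0" "\<not> b j0" by (auto simp: V_def)
  \<comment> \<open>The window starts with run \<open>- 1\<close>, the vertex run that ends where
    arc 0 begins.\<close>
  obtain j where j: "j mod (2*n) = j0 mod (2*n)" "st (- 1) \<le> j" "j < st (- 1) + 2 * n"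
    by (rule obtain_shift_int)
  have v: "v = vx j" "\<not> b j" using j0 vx_cong[OF j(1)] b_cong[OF j(1)] by auto
  have "odd (idx j)" using v even_idx by blast
  then obtain k where "idx j = 2 * k + 1" by (rule oddE)
  then have k: "idx j = 2 * (k + 1) - 1" by simp
  have "- 1 \<le> idx j" "idx j < - 1 + m * 2"
    using j st_le_iff[of "-1" j] st_le_iff[of "-1+m*2" j] st_add_mk[of "-1" 2] by auto
  then have "k + 1 \<in> {0..<m}" using k by auto
  moreover have "idx j + 1 = 2 * (k + 1)" using k by simp
  then have "vx j = vx (st (2 * (k+1)))"
    using vx_run[of "idx j" j] vx_run[of "idx j" "st (2 * (k+1))"] \<open>odd (idx j)\<close> idx_eq_iff[of j "idx j"]
    by simp
  then have "v = pathstart (arc (k + 1))" using v by (simp only: arc_ends)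
  ultimately show "v \<in> (\<lambda>k. pathstart (arc k)) ` {0..<m}" by (rule rev_image_eqI)
next
  fix v assume "v \<in> (\<lambda>k. pathstart (arc k)) ` {0..<m}"
  then obtain k where "v = vx (st (2*k))" by (auto simp: arc_ends)
  then have "v = vx (st (2 * k - 1))" using vx_st_next[of "k - 1"] by (simp add: algebra_simps)
  moreover have "\<not> b (st (2 * k - 1))" using even_idx[of "st (2 * k - 1)"] by simp
  ultimately show "v \<in> V" by (auto simp: V_def)
qed

lemma image_nat_m: "f ` {0..<m} = (\<lambda>i. f (int i)) ` {..<nat m}"
proof -
  have "{0..<m} = int ` {..<nat m}"
    using image_int_atLeastLessThan[of 0 "nat m"] m_pos by (simp add: lessThan_atLeast0)
  then show ?thesis by (simp add: image_image)
qed

lemma Suc_mod_m: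
  assumes "i < nat m" and f: "\<And>k. f (k + m) = f k"
  shows "f (int (Suc i mod nat m)) = f (int i + 1)"
proof (cases "Suc i = nat m")
  case True
  then have "int i + 1 = 0 + m" by linarith
  then show ?thesis using f[of 0] True by simp
next
  case False
  then show ?thesis using assms by (simp add: add.commute)
qed

lemma reuleaux_R: "reuleaux_polygon R V"
proof -
  define c S T where "c i = vx (st (2 * int i) + n)"
    and "S i = pi * of_int (st (2 * int i)) / of_int n"
    and "T i = pi * of_int (st (2 * int i + 1)) / of_int n" for i :: nat
  have A: "part_circlepath (c i) 1 (S i) (T i) = arc (int i)" for i
    by (simp add: arc_def c_def S_def T_def)
  have st_m: "st (2 * (k + m)) = st (2*k) + 2 * n" for k
    using st_add_mk[of "2*k" 2] by (simp add: algebra_simps)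
  have "arc_boundary R 1 (nat m) c S T"
    unfolding arc_boundary_def Let_def A
  proof (intro conjI allI impI)
    show "0 < nat m" using m_pos by simp
    show "S i < T i" "T i < S i + 2 * pi" for i
      unfolding S_def T_def by (rule arc_angles)+
    show "frontier R = (\<Union>i<nat m. path_image (arc (int i)))"
      unfolding frontier_R range_bd_eq image_nat_m[of "\<lambda>k. path_image (arc k)"] by simp
    fix i assume i: "i < nat m"
    show "pathfinish (arc (int i)) = pathstart (arc (int (Suc i mod nat m)))"
    proof -
      have "vx (st (2 * int (Suc i mod nat m))) = vx (st (2 * (int i + 1)))"
        by (intro Suc_mod_m[OF i, of "\<lambda>k. vx (st (2*k))"]) (simp only: st_m vx_add_2n)
      then show ?thesis unfolding arc_ends using vx_st_next[of "int i"] by (simp add: distrib_left)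
    qed
    show "c i \<noteq> c (Suc i mod nat m)"
    proof -
      have "vx (st (2 * (k + m)) + n) = vx (st (2*k) + n)" for k
        using vx_add_2n[of "st (2*k) + n"] by (simp only: st_m add.assoc add.commute[of n])
      then have "vx (st (2 * int (Suc i mod nat m)) + n) = vx (st (2 * (int i + 1)) + n)"
        by (intro Suc_mod_m[OF i, of "\<lambda>k. vx (st (2*k) + n)"])
      then show ?thesis unfolding c_def using arc_centres_neq[of "int i"] by simp
    qed
    fix j assume j: "j < nat m" "i \<noteq> j"
    show "path_image (arc (int i)) \<inter> path_image (arc (int j)) \<subseteq>
       {pathstart (arc (int i)), pathfinish (arc (int i))} \<inter>
       {pathstart (arc (int j)), pathfinish (arc (int j))}"
      using arcs_meet[of "int i" "int j"] arcs_meet[of "int j" "int i"] i j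
      by (cases "i < j") fastforce+
  qed auto
  moreover have "V = (\<lambda>i. pathstart (part_circlepath (c i) 1 (S i) (T i))) ` {..<nat m}"
    unfolding A V_eq image_nat_m ..
  ultimately show ?thesis
    unfolding reuleaux_polygon_def
    using compact_R compact_imp_closed convex_R interior_R constant_width_R by blast
qed

lemma V_subset_X: "V \<subseteq> X"
  by (auto simp: V_def)

lemma inscribed: "reinhardt_inscribed (nat n) P R V"
  unfolding reinhardt_inscribed_def
  using convex_ngon_P equilateral_P reuleaux_R diameter_R diameter_P vertices_P V_subset_X X_subset_bd frontier_R
  by auto

text \<open>The second alternative occurs when \<open>a\<close> is the first sector after the vertex
  run of \<open>c\<close>: that sector still starts at the same vertex.\<close>

lemma vx_eq_imp_idx:
  assumes "vx a = vx c" "\<not> b c"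
  shows "idx a mod (2*m) = idx c mod (2*m) \<or> idx (a - 1) mod (2*m) = idx c mod (2*m)"
proof -
  obtain a' where a': "a' mod (2*n) = a mod (2*n)" "c \<le> a'" "a' < c + 2*n"
    by (rule obtain_shift_int)
  have va: "vx a' = vx c" using vx_cong[OF a'(1)] assms by simp
  have idx_const: "idx k = idx l" if "k \<le> l" "\<And>i. k \<le> i \<Longrightarrow> i \<le> l \<Longrightarrow> \<not> b i" for k l
    using that
  proof (induction l rule: int_ge_induct)
    case (step i)
    then show ?case using idx_Suc[of i] by simp
  qed simp
  show ?thesis
  proof (cases "a' \<le> c + n")
    case True
    show ?thesis
    proof (cases "a' = c")
      case True
      then show ?thesis using idx_cong[OF a'(1)] by simp
    next
      case False
      have "idx c = idx (a' - 1)"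
        using vx_eq_imp_not_b[OF va[symmetric]] True False a' by (intro idx_const) auto
      moreover have "(a' - 1) mod (2*n) = (a - 1) mod (2*n)" using a'(1) by (metis mod_diff_left_eq)
      ultimately show ?thesis using idx_cong by metis
    qed
  next
    case False
    have "vx a' = vx (c + 2 * n)" using va by simp
    then have "\<not> b i" if "a' \<le> i" "i \<le> c + 2*n" for i
      using vx_eq_imp_not_b[of a' "c + 2*n" i] that False assms(2) b_add_2n[of c] by (cases "i = c + 2*n") auto
    then have "idx a' = idx (c + 2*n)" using a' by (intro idx_const) auto
    moreover have "(c + 2*n) mod (2*n) = c mod (2*n)" by simp
    ultimately show ?thesis using idx_cong[OF a'(1)] idx_cong[of "c + 2*n" c] by metis
  qed
qed

lemma vx_eq_iff_idx:
  assumes "\<not> b a" "\<not> b c"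
  shows "vx a = vx c \<longleftrightarrow> idx a mod (2*m) = idx c mod (2*m)"
proof
  assume "vx a = vx c"
  then consider "idx a mod (2*m) = idx c mod (2*m)" | "idx (a - 1) mod (2*m) = idx c mod (2*m)"
    using vx_eq_imp_idx assms by blast
  then show "idx a mod (2*m) = idx c mod (2*m)"
  proof cases
    case 2
    then have "even (idx (a - 1)) \<longleftrightarrow> even (idx c)"
      by (metis dvd_mod_iff dvd_triv_left)
    then have "\<not> b (a - 1)" using even_idx assms by blast
    then have "idx a = idx (a - 1)" using idx_Suc[of "a - 1"] assms by simp
    then show ?thesis using 2 by simp
  qed
next
  assume "idx a mod (2*m) = idx c mod (2*m)"
  then obtain l where "idx a = idx c + 2 * m * l" by (metis mod_eqE mult.commute add.commute)
  then have "idx a = idx (c + n * (2 * l))" unfolding idx_add_nk by simp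
  then have "vx a = vx (c + n * (2 * l))"
    using vx_run[of "idx a" a] vx_run[of "idx a" "c + n * (2*l)"] idx_eq_iff[of a "idx a"]
      idx_eq_iff[of "c + n * (2*l)" "idx a"] assms even_idx[of a] by simp
  also have "\<dots> = vx c" by (rule vx_cong) (simp add: mult.assoc[symmetric] mult.commute[of n 2])
  finally show "vx a = vx c" .
qed

subsection \<open>The star polygon and the composition\<close>

text \<open>Each step of the star goes on to the next run and to the opposite side; starting at \<open>st 0 + n\<close>
  puts every \<open>pos k\<close> on a run of non-arc sectors.\<close>

definition pos :: "int \<Rightarrow> int" where
  "pos k = st k + (k + 1) * n"

lemma idx_pos: "idx (pos k) = k + (k + 1) * m"
  using idx_add_nk[of "st k" "k + 1"] by (simp add: pos_def mult.commute)

lemma odd_idx_pos: "odd (idx (pos k))"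
  using odd_m by (cases "even k") (auto simp: idx_pos)

lemma not_b_pos: "\<not> b (pos k)"
  using odd_idx_pos even_idx by blast

lemma idx_pos_mod: "idx (pos k) mod m = k mod m"
  by (simp add: idx_pos)

lemma mod_2m_imp: "x mod (2*m) = y mod (2*m) \<Longrightarrow> x mod m = (y::int) mod m"
  by (metis mod_mod_cancel dvd_triv_right)

text \<open>All \<open>idx (pos k)\<close> are odd and \<open>m\<close> is odd, so their residues
  modulo \<open>2 * m\<close> are determined by those modulo \<open>m\<close>.\<close>

lemma vx_pos_eq_iff: "vx (pos k) = vx (pos l) \<longleftrightarrow> k mod m = l mod m"
proof -
  have "idx (pos k) mod (2*m) = idx (pos l) mod (2*m) \<longleftrightarrow> k mod m = l mod m"
  proof
    assume "k mod m = l mod m"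
    then have "m dvd idx (pos k) - idx (pos l)" using idx_pos_mod by (metis mod_eq_dvd_iff)
    moreover have "2 dvd idx (pos k) - idx (pos l)" using odd_idx_pos by simp
    moreover have "coprime 2 m" using odd_m by simp
    ultimately have "2 * m dvd idx (pos k) - idx (pos l)" by (simp add: divides_mult)
    then show "idx (pos k) mod (2*m) = idx (pos l) mod (2*m)" by (simp add: mod_eq_dvd_iff)
  qed (use mod_2m_imp idx_pos_mod in metis)
  then show ?thesis by (simp add: vx_eq_iff_idx not_b_pos)
qed

lemma V_imp_pos: "v \<in> V \<Longrightarrow> \<exists>k\<in>{0..<m}. v = vx (pos k)"
proof -
  assume "v \<in> V"
  then obtain j where j: "v = vx j" "\<not> b j" by (auto simp: V_def)
  define k where "k = idx j mod m"
  have "idx (pos k) mod m = idx j mod m" by (simp add: idx_pos_mod k_def)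
  then have "m dvd idx (pos k) - idx j" by (simp add: mod_eq_dvd_iff)
  moreover have "2 dvd idx (pos k) - idx j" using odd_idx_pos j even_idx by simp
  moreover have "coprime 2 m" using odd_m by simp
  ultimately have "2 * m dvd idx (pos k) - idx j" by (simp add: divides_mult)
  then have "vx (pos k) = vx j" by (simp add: mod_eq_dvd_iff vx_eq_iff_idx not_b_pos j)
  then show ?thesis using m_pos j by (intro bexI[of _ k]) (auto simp: k_def)
qed

lemma vx_pos_in_V [simp]: "vx (pos k) \<in> V"
  using not_b_pos by (auto simp: V_def)

text \<open>Both ends of a vertex run give the same vertex. The antipode of the far end of the run
  of \<open>pos k\<close> is exactly \<open>pos (k + 1)\<close>.\<close>

lemma dist_pos: "dist (vx (pos k)) (vx (pos (k + 1))) = 1"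
proof -
  have "idx (pos k) + 1 = k + 1 + m * (k + 1)" by (simp add: idx_pos algebra_simps)
  then have "st (idx (pos k) + 1) = st (k + 1 + m * (k + 1))" by (rule arg_cong)
  also have "\<dots> = st (k + 1) + (k + 1) * n" unfolding st_add_mk by (simp add: mult.commute)
  finally have s: "st (idx (pos k) + 1) = st (k + 1) + (k + 1) * n" .
  have "vx (pos k) = vx (st (k + 1) + (k + 1) * n)"
    using vx_run[OF odd_idx_pos[of k], of "pos k"] vx_run[OF odd_idx_pos[of k], of "st (k + 1) + (k + 1) * n"]
      idx_eq_iff[of "pos k" "idx (pos k)"] by (simp add: s[symmetric])
  moreover have "pos (k + 1) = st (k + 1) + (k + 1) * n + n" by (simp add: pos_def algebra_simps)
  ultimately show ?thesis using dist_vx_n by simp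
qed

text \<open>Points at distance 1 are antipodal at some \<open>a\<close>. Modulo \<open>m\<close>
  both run indices occur among \<open>idx a\<close> and \<open>idx (a - 1)\<close>; since they
  differ, these two are consecutive.\<close>

lemma dist_pos_iff:
  "dist (vx (pos k)) (vx (pos l)) = 1 \<longleftrightarrow> l mod m = (k + 1) mod m \<or> k mod m = (l + 1) mod m"
proof
  assume "l mod m = (k + 1) mod m \<or> k mod m = (l + 1) mod m"
  then show "dist (vx (pos k)) (vx (pos l)) = 1"
    using dist_pos[of k] dist_pos[of l] vx_pos_eq_iff[of l "k + 1"] vx_pos_eq_iff[of k "l + 1"]
    by (auto simp: dist_commute)
next
  assume d: "dist (vx (pos k)) (vx (pos l)) = 1"
  then have neq: "k mod m \<noteq> l mod m" using vx_pos_eq_iff[of k l] by auto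
  obtain a where a: "vx (pos k) = vx a" "vx (pos l) = vx (a + n)"
    using dist_1_X[OF _ _ d] by auto
  have 1: "idx a mod m = k mod m \<or> idx (a - 1) mod m = k mod m"
    using vx_eq_imp_idx[of a "pos k"] a not_b_pos mod_2m_imp idx_pos_mod by metis
  have "idx (a + n) mod m = l mod m \<or> idx (a + n - 1) mod m = l mod m"
    using vx_eq_imp_idx[of "a + n" "pos l"] a not_b_pos mod_2m_imp idx_pos_mod by metis
  moreover have "a + n - 1 = a - 1 + n" by simp
  ultimately have 2: "idx a mod m = l mod m \<or> idx (a - 1) mod m = l mod m"
    by (metis idx_add_n mod_add_self2)
  from 1 2 neq have 3: "(idx a mod m = k mod m \<and> idx (a - 1) mod m = l mod m) \<or>
     (idx a mod m = l mod m \<and> idx (a - 1) mod m = k mod m)" by metis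
  then have "idx a = idx (a - 1) + 1"
    using neq idx_Suc[of "a - 1"] by (cases "b a"; cases "b (a - 1)") auto
  then show "l mod m = (k + 1) mod m \<or> k mod m = (l + 1) mod m" using 3 by (metis mod_add_left_eq)
qed

text \<open>A side lies in the arc opposite \<open>v\<close> precisely if \<open>v\<close> is the
  antipode of its sector. The set \<open>R'\<close> is general because a composition may be read off
  from any circumscribed Reuleaux polygon.\<close>

lemma sides_card:
  assumes v: "v \<in> X" and R': "diameter R' = 1" "X \<subseteq> frontier R'"
  shows "sides_in_arc P (opposite_arc R' v) = card {j\<in>{0..<2*n}. b j \<and> vx (j + n) = v}"
proof -
  let ?J = "{j\<in>{0..<2*n}. b j \<and> vx (j + n) = v}"
  let ?s = "\<lambda>j. closed_segment (vx j) (vx (j + 1))"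
  have vs: "vertices (?s j) = {vx j, vx (j + 1)}" for j
    by (auto simp: vertices_def extreme_point_of_segment)
  have opp: "vertices (?s j) \<subseteq> opposite_arc R' v \<longleftrightarrow> dist v (vx j) = 1 \<and> dist v (vx (j + 1)) = 1" for j
    using R' vx_in_X by (auto simp: vs opposite_arc_def simp del: vx_in_X)
  have key: "vertices (?s j) \<subseteq> opposite_arc R' v \<longleftrightarrow> vx (j + n) = v" if "b j" for j
  proof
    assume "vertices (?s j) \<subseteq> opposite_arc R' v"
    then show "vx (j + n) = v" using both_dist_1[of v j] v X_subset_R that by (auto simp: opp)
  next
    assume "vx (j + n) = v"
    moreover have "vx (j + n) = vx (j + 1 + n)"
      using vx_Suc[of "j + n"] that by (simp add: b_add_n algebra_simps)
    ultimately have "dist v (vx j) = 1" "dist v (vx (j + 1)) = 1"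
      using dist_vx_n[of j] dist_vx_n[of "j + 1"] by (simp_all add: dist_commute)
    then show "vertices (?s j) \<subseteq> opposite_arc R' v" by (simp add: opp)
  qed
  have "{e. e edge_of P \<and> vertices e \<subseteq> opposite_arc R' v} = ?s ` ?J"
  proof (intro equalityI subsetI)
    fix e assume "e \<in> {e. e edge_of P \<and> vertices e \<subseteq> opposite_arc R' v}"
    then obtain j where j: "b j" "e = ?s j" "vx (j + n) = v" using edge_imp key by blast
    have "vx (j mod (2*n) + 1) = vx (j + 1)" "vx (j mod (2*n) + n) = vx (j + n)"
      by (rule vx_cong, simp add: mod_add_left_eq)+
    then have "e = ?s (j mod (2*n))" "j mod (2*n) \<in> ?J"
      using j vx_eq_mod[of j] by simp_all
    then show "e \<in> ?s ` ?J" by blast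
  next
    fix e assume "e \<in> ?s ` ?J"
    then show "e \<in> {e. e edge_of P \<and> vertices e \<subseteq> opposite_arc R' v}" using edge_if key by blast
  qed
  moreover have "inj_on ?s ?J"
  proof (rule inj_onI)
    fix i j assume ij: "i \<in> ?J" "j \<in> ?J" "?s i = ?s j"
    then consider "vx i = vx j" | "vx i = vx (j + 1)" "vx (i + 1) = vx j"
      by (auto simp: doubleton_eq_iff)
    then show "i = j"
    proof cases
      case 1
      then show ?thesis using vx_inj[of i j] ij by simp
    next
      case 2
      \<comment> \<open>One chord run through in both directions about the same centre would make
        \<open>E\<close> return after two sectors.\<close>
      have "vx (i + n) = vx (j + n)" using ij by simp
      then have "E (of_int i) = E (of_int j) + (E (of_int j + 1) - E (of_int j))"
        and "E (of_int i) + (E (of_int i + 1) - E (of_int i)) = E (of_int j)"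
        using 2 ij by (simp_all add: vx_Suc vx_add_n)
      then have "E (of_int j + 2) = E (of_int j)"
        using E_add[of "of_int i" 1] E_add[of "of_int j" 1] E_add[of "of_int j" 2] E_add[of 1 1] by simp
      then have "E (of_int (j + 2)) = E (of_int j)" by simp
      then have "(j + 2) mod (2*n) = j mod (2*n)" unfolding E_int_eq_iff .
      then have "2 * n dvd 2" by (simp add: mod_eq_dvd_iff)
      then have "2 * n \<le> 2" by (rule zdvd_imp_le) simp
      then show ?thesis using n_ge2 by simp
    qed
  qed
  ultimately show ?thesis unfolding sides_in_arc_def by (simp add: card_image)
qed

text \<open>The sectors counted are the antipodes of the run containing \<open>pos k\<close>, which
  is run \<open>k\<close> shifted by a multiple of \<open>n\<close>.\<close>

lemma card_opposite:
  "card {j\<in>{0..<2*n}. b j \<and> vx (j + n) = vx (pos k)} = nat (st (k + 1) - st k)"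
proof -
  define q where "q = idx (pos k)"
  have "odd q" by (simp add: q_def odd_idx_pos)
  let ?f = "\<lambda>i. (i - n) mod (2*n)"
  have "{j\<in>{0..<2*n}. b j \<and> vx (j + n) = vx (pos k)} = ?f ` {st q..<st (q + 1)}"
  proof (intro equalityI subsetI)
    fix j assume j: "j \<in> {j\<in>{0..<2*n}. b j \<and> vx (j + n) = vx (pos k)}"
    then have "idx (j + n) mod (2*m) = q mod (2*m)"
      using vx_eq_iff_idx[of "j + n" "pos k"] by (simp add: b_add_n not_b_pos q_def)
    then obtain l where l: "q = idx (j + n) + m * (2 * l)"
      by (metis mod_eqE mult.commute mult.left_commute add.commute)
    then have "idx (j + n + n * (2 * l)) = q" unfolding idx_add_nk by simp
    then have "j + n + n * (2 * l) \<in> {st q..<st (q + 1)}" by (simp add: idx_eq_iff)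
    moreover have "j + n + n * (2 * l) - n = j + 2 * n * l" by simp
    then have "?f (j + n + n * (2 * l)) = j" using j by (metis (no_types, lifting) atLeastLessThan_iff mem_Collect_eq mod_mult_self2 mod_pos_pos_trivial)
    ultimately show "j \<in> ?f ` {st q..<st (q + 1)}" by force
  next
    fix j assume "j \<in> ?f ` {st q..<st (q + 1)}"
    then obtain i where i: "j = ?f i" "idx i = q" by (auto simp: idx_eq_iff)
    have "j mod (2*n) = (i - n) mod (2*n)" using i by simp
    then have jn: "(j + n) mod (2*n) = i mod (2*n)" by (metis diff_add_cancel mod_add_left_eq)
    have "\<not> b i" using i \<open>odd q\<close> even_idx by blast
    then have "vx i = vx (pos k)" by (simp add: vx_eq_iff_idx not_b_pos i q_def)
    moreover have "\<not> b (j + n)" using b_cong[OF jn] \<open>\<not> b i\<close> by simp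
    ultimately show "j \<in> {j\<in>{0..<2*n}. b j \<and> vx (j + n) = vx (pos k)}"
      using vx_cong[OF jn] i by (simp add: b_add_n)
  qed
  moreover have "inj_on ?f {st q..<st (q + 1)}"
  proof (rule inj_onI)
    fix x y assume xy: "x \<in> {st q..<st (q + 1)}" "y \<in> {st q..<st (q + 1)}" "?f x = ?f y"
    have "st (q + 1) \<le> st (q + m * 2)" using m_ge3 by simp
    then have "st (q + 1) \<le> st q + n * 2" unfolding st_add_mk .
    then have "\<bar>x - y\<bar> < 2 * n" using xy by auto
    moreover have "2 * n dvd x - y" using xy(3) by (simp add: mod_eq_dvd_iff)
    ultimately show "x = y" using zdvd_imp_le[of "2*n" "x - y"] zdvd_imp_le[of "2*n" "y - x"]
      by (metis abs_of_nonneg dvd_imp_le_int dvd_abs_iff abs_ge_zero eq_iff_diff_eq_0 linorder_not_less n_pos(1) abs_of_pos mult_pos_pos zero_less_numeral)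
  qed
  moreover have "st (q + 1) - st q = st (k + 1) - st k"
    using st_add_mk[of k "k + 1"] st_add_mk[of "k + 1" "k + 1"]
    by (simp add: q_def idx_pos algebra_simps)
  ultimately show ?thesis by (simp add: card_image)
qed

definition ws0 :: "complex list" where
  "ws0 = map (\<lambda>i. vx (pos (int i))) [0..<nat m]"

lemma nat_mod_m_iff:
  assumes "i < nat m" "j < nat m"
  shows "int j mod m = (int i + 1) mod m \<longleftrightarrow> j = Suc i mod nat m"
proof -
  have "(int i + 1) mod m = int (Suc i mod nat m)"
    using m_pos by (simp add: zmod_int add.commute)
  moreover have "int j mod m = int j" using assms by simp
  ultimately show ?thesis by simp
qed

lemma star_ws0: "star_traversal R V ws0"
  unfolding star_traversal_def
proof (intro conjI allI impI)
  have "set ws0 = (\<lambda>k. vx (pos k)) ` {0..<m}"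
    unfolding image_nat_m by (simp add: ws0_def lessThan_atLeast0)
  then show "set ws0 = V" using V_imp_pos by (auto simp del: image_eqI) (metis image_eqI atLeastLessThan_iff)
  show "distinct ws0" by (simp add: ws0_def distinct_map inj_on_def vx_pos_eq_iff)
  show "odd (length ws0)" using odd_m m_pos by (simp add: ws0_def even_nat_iff)
  fix i j assume "i < length ws0" "j < length ws0"
  then have ij: "i < nat m" "j < nat m" by (auto simp: ws0_def)
  then show "dist (ws0 ! i) (ws0 ! j) = diameter R \<longleftrightarrow>
      j = Suc i mod length ws0 \<or> i = Suc j mod length ws0"
    using dist_pos_iff[of "int i" "int j"] nat_mod_m_iff[OF ij] nat_mod_m_iff[OF ij(2,1)]
    by (simp add: ws0_def diameter_R)
qed


subsection \<open>Uniqueness of the composition\<close>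

definition run_length :: "int \<Rightarrow> nat" where
  "run_length k = nat (st (k + 1) - st k)"

lemma run_length_cong: "k mod m = l mod m \<Longrightarrow> run_length k = run_length l"
proof -
  have "run_length k = run_length (k mod m)" for k
  proof -
    have "run_length k = run_length (k mod m + m * (k div m))" by simp
    also have "\<dots> = run_length (k mod m)"
      using st_add_mk[of "k mod m" "k div m"] st_add_mk[of "k mod m + 1" "k div m"]
      by (simp add: run_length_def algebra_simps)
    finally show ?thesis .
  qed
  then show "k mod m = l mod m \<Longrightarrow> run_length k = run_length l" by metis
qed

lemma sides_pos:
  assumes "diameter R' = 1" "X \<subseteq> frontier R'"
  shows "sides_in_arc P (opposite_arc R' (vx (pos k))) = run_length k"
  using sides_card[OF _ assms, of "vx (pos k)"] card_opposite[of k] by (simp add: run_length_def)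

lemma has_composition_ws0:
  "has_composition (nat n) P (map (\<lambda>v. sides_in_arc P (opposite_arc R v)) ws0)"
  unfolding has_composition_def using inscribed star_ws0 by blast

lemma card_V: "card V = nat m"
  using star_ws0 distinct_card[of ws0] by (simp add: star_traversal_def ws0_def)

text \<open>All indices of a point outside \<open>V\<close> are arc sectors, so by
  \<open>vx_inj\<close> they agree modulo \<open>2n\<close> and have a single antipode.\<close>

lemma in_V_if_two_neighbours:
  assumes "v \<in> X" "y \<in> X" "z \<in> X" "dist v y = 1" "dist v z = 1" "y \<noteq> z"
  shows "v \<in> V"
proof (rule ccontr)
  assume v: "v \<notin> V"
  obtain a where a: "v = vx a" "y = vx (a + n)" using dist_1_X assms by metis
  obtain c where c: "v = vx c" "z = vx (c + n)" using dist_1_X assms by metis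
  have "b a" "b c" using v a c by (auto simp: V_def)
  then have "a mod (2*n) = c mod (2*n)" using vx_inj[of a c] a(1) c(1) by metis
  then have "(a + n) mod (2*n) = (c + n) mod (2*n)" by (metis mod_add_left_eq)
  then have "vx (a + n) = vx (c + n)" by (rule vx_cong)
  then show False using a c assms(6) by simp
qed

text \<open>On the cycle of residues modulo \<open>m\<close>, a step against the direction of the
  previous one returns to the place two steps before, which \<open>nonback\<close> forbids.\<close>

lemma walk_direction:
  fixes K :: "nat \<Rightarrow> int"
  assumes step: "\<And>i. K (Suc i) mod m = (K i + 1) mod m \<or> K i mod m = (K (Suc i) + 1) mod m"
    and nonback: "\<And>i. K (Suc (Suc i)) mod m \<noteq> K i mod m"
  shows "\<exists>e\<in>{1, -1}. \<forall>i. K i mod m = (K 0 + e * int i) mod m"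
proof -
  have "\<exists>e\<in>{1, -1::int}. K 1 mod m = (K 0 + e) mod m"
    using step[of 0]
  proof
    assume "K 0 mod m = (K (Suc 0) + 1) mod m"
    then have "m dvd K 0 - (K 1 + 1)" by (simp add: mod_eq_dvd_iff)
    moreover have "K 0 - (K 1 + 1) = - (K 1 - (K 0 + - 1))" by simp
    ultimately have "m dvd - (K 1 - (K 0 + - 1))" by metis
    then show ?thesis unfolding dvd_minus_iff mod_eq_dvd_iff by blast
  qed auto
  then obtain e where e: "e \<in> {1, -1::int}" "K 1 mod m = (K 0 + e) mod m" by blast
  have "K i mod m = (K 0 + e * int i) mod m \<and> K (Suc i) mod m = (K 0 + e * int (Suc i)) mod m" for i
  proof (induction i)
    case 0
    then show ?case using e by simp
  next
    case (Suc i)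
    then have "m dvd K i - (K 0 + e * int i)" "m dvd K (Suc i) - (K 0 + e * int (Suc i))"
      by (simp_all add: mod_eq_dvd_iff)
    then obtain u v where uv: "K i = K 0 + e * int i + m * u" "K (Suc i) = K 0 + e * int (Suc i) + m * v"
      by (metis dvdE add.commute diff_add_cancel)
    consider "m dvd K (Suc (Suc i)) - (K (Suc i) + 1)" | "m dvd K (Suc i) - (K (Suc (Suc i)) + 1)"
      using step[of "Suc i"] by (auto simp: mod_eq_dvd_iff)
    then have "\<exists>e'\<in>{1,-1}. \<exists>w. K (Suc (Suc i)) = K (Suc i) + e' + m * w"
    proof cases
      case 1
      then obtain w where "K (Suc (Suc i)) - (K (Suc i) + 1) = m * w" by blast
      then show ?thesis by (intro bexI[of _ 1] exI[of _ w]) auto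
    next
      case 2
      then obtain w where "K (Suc i) - (K (Suc (Suc i)) + 1) = m * w" by blast
      then show ?thesis by (intro bexI[of _ "-1"] exI[of _ "-w"]) auto
    qed
    then obtain e' w where e': "e' \<in> {1,-1}" "K (Suc (Suc i)) = K (Suc i) + e' + m * w" by blast
    have "e' = e"
    proof (rule ccontr)
      assume "e' \<noteq> e"
      then have "e' = - e" using e e' by auto
      then have "K (Suc (Suc i)) = K i + m * (v + w - u)"
        using e' uv by (simp add: algebra_simps)
      then show False using nonback[of i] by simp
    qed
    then have "K (Suc (Suc i)) = K 0 + e * int (Suc (Suc i)) + m * (v + w)"
      using e' uv by (simp add: algebra_simps)
    then show ?case using Suc by simp
  qed
  then show ?thesis using e(1) by blast
qed

text \<open>Every point of a star has two distinct neighbours at distance 1 and hence lies in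
  \<open>V\<close>, so the star walks along the cycle \<open>pos\<close> without turning back. It
  closes after \<open>M\<close> steps, so \<open>m\<close> divides \<open>M\<close>, while
  \<open>M\<close> is at most \<open>card V = m\<close>.\<close>

lemma composition_unique:
  assumes "has_composition N P ks"
  shows "length ks = nat m \<and>
    (\<exists>c. \<exists>e\<in>{1, -1}. \<forall>i<nat m. ks ! i = run_length (c + e * int i))"
proof -
  obtain R' V' ws where ins: "reinhardt_inscribed N P R' V'" and star: "star_traversal R' V' ws"
    and ks: "ks = map (\<lambda>v. sides_in_arc P (opposite_arc R' v)) ws"
    using assms unfolding has_composition_def by blast
  have R': "diameter R' = 1" "X \<subseteq> frontier R'" and V'X: "V' \<subseteq> X"
    using ins by (auto simp: reinhardt_inscribed_def diameter_P vertices_P)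
  define M where "M = length ws"
  have ws: "set ws = V'" "distinct ws" "odd M"
    and dist_ws: "\<And>i j. i < M \<Longrightarrow> j < M \<Longrightarrow> dist (ws ! i) (ws ! j) = 1 \<longleftrightarrow> j = Suc i mod M \<or> i = Suc j mod M"
    using star by (auto simp: star_traversal_def M_def R')
  \<comment> \<open>In a star of length 1 the only vertex would have distance 1 from itself.\<close>
  have "M \<noteq> 1" using dist_ws[of 0 0] by auto
  then have M3: "M \<ge> 3" using ws(3) by presburger
  define W where "W i = ws ! (i mod M)" for i
  have less_M: "i mod M < M" for i using M3 by simp
  have W_V': "W i \<in> V'" for i using ws(1) less_M[of i] by (auto simp: W_def M_def)
  have W_eq: "W i = W j \<longleftrightarrow> i mod M = j mod M" for i j
    using ws(2) less_M[of i] less_M[of j] by (simp add: W_def M_def nth_eq_iff_index_eq)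
  have dist_W: "dist (W i) (W (Suc i)) = 1" for i
    using dist_ws[of "i mod M" "Suc i mod M"] M3 by (simp add: W_def mod_Suc_eq)
  have W2: "W i \<noteq> W (Suc (Suc i))" for i
  proof
    assume "W i = W (Suc (Suc i))"
    then have "(i + 2) mod M = i mod M" by (simp add: W_eq)
    then have "M dvd i + 2 - i" using mod_eq_dvd_iff_nat[of i "i + 2" M] by simp
    then have "M dvd 2" by simp
    then have "M \<le> 2" by (rule dvd_imp_le) simp
    then show False using M3 by simp
  qed
  have WV: "W i \<in> V" for i
  proof -
    have "W (i + M) = W i" by (simp add: W_eq)
    obtain j where j: "i + M = Suc j" using M3 by (metis add_eq_0_iff_both_eq_0 not0_implies_Suc not_numeral_le_zero)
    have "W (Suc j) \<in> V"
      using in_V_if_two_neighbours[of "W (Suc j)" "W j" "W (Suc (Suc j))"] dist_W W2 W_V' V'X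
      by (metis dist_commute subsetD)
    then show ?thesis using j \<open>W (i + M) = W i\<close> by simp
  qed
  then have "\<forall>i. \<exists>k. W i = vx (pos k)" using V_imp_pos by blast
  then obtain K where K: "\<And>i. W i = vx (pos (K i))" by metis
  have "\<exists>e\<in>{1, -1}. \<forall>i. K i mod m = (K 0 + e * int i) mod m"
  proof (rule walk_direction)
    show "K (Suc i) mod m = (K i + 1) mod m \<or> K i mod m = (K (Suc i) + 1) mod m" for i
      using dist_W[of i] by (simp add: K dist_pos_iff)
    show "K (Suc (Suc i)) mod m \<noteq> K i mod m" for i
      using W2[of i] by (auto simp: K vx_pos_eq_iff)
  qed
  then obtain e where e: "e \<in> {1, -1}" "\<And>i. K i mod m = (K 0 + e * int i) mod m" by blast
  have "M = nat m"
  proof (rule antisym)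
    have "V' \<subseteq> V"
    proof
      fix v assume "v \<in> V'"
      then obtain i where "i < M" "v = ws ! i" using ws(1) by (metis in_set_conv_nth M_def)
      then have "v = W i" by (simp add: W_def)
      then show "v \<in> V" using WV by simp
    qed
    moreover have "finite V" using finite_X V_subset_X finite_subset by blast
    ultimately have "card V' \<le> card V" by (rule card_mono[rotated])
    then show "M \<le> nat m" using ws distinct_card[of ws] by (simp add: card_V M_def)
    have "W M = W 0" by (simp add: W_eq)
    then have "(K 0 + e * int M) mod m = K 0 mod m" using e(2)[of M] by (simp add: K vx_pos_eq_iff)
    then have "m dvd e * int M" by (simp add: mod_eq_dvd_iff)
    then have "m dvd int M" using e(1) by auto
    then have "m \<le> int M" using M3 by (intro zdvd_imp_le) auto
    then show "nat m \<le> M" by simp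
  qed
  moreover have "ks ! i = run_length (K 0 + e * int i)" if "i < M" for i
  proof -
    have "ks ! i = sides_in_arc P (opposite_arc R' (W i))"
      using that by (simp add: ks M_def W_def)
    also have "\<dots> = run_length (K i)" unfolding K by (rule sides_pos[OF R'])
    also have "\<dots> = run_length (K 0 + e * int i)" using e(2) by (rule run_length_cong)
    finally show ?thesis .
  qed
  ultimately show ?thesis using e(1) by (auto simp: ks M_def)
qed


text \<open>A shift by \<open>s\<close> runs moves all run boundaries by the same amount, but
  negates \<open>b\<close> if \<open>s\<close> is odd; hence the factor 2.\<close>

lemma b_period_if_run_length_period:
  assumes "\<And>k. run_length (k + s) = run_length k"
  shows "b (j + 2 * (st s - st 0)) \<longleftrightarrow> b j"
proof -
  define T where "T = st s - st 0"
  define D where "D k = st (k + s) - st k" for k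
  have "D (k + 1) = D k" for k
  proof -
    have "st k < st (k + 1)" "st (k + s) < st (k + s + 1)" by simp_all
    then have "st (k + s + 1) - st (k + s) = st (k + 1) - st k"
      using assms[of k] unfolding run_length_def by linarith
    then show ?thesis by (simp add: D_def algebra_simps)
  qed
  then have "D (0 + k) = D 0" for k
    using periodic_int_mult[where f=D and c=1 and j=0 and k=k] by simp
  then have st: "st (k + s) = st k + T" for k by (simp add: D_def T_def algebra_simps)
  have "i \<le> idx (j + T) \<longleftrightarrow> i \<le> idx j + s" for i j
    using st[of "i - s"] st_le_iff[of i "j + T"] st_le_iff[of "i - s" j] by auto
  then have "idx (j + T) = idx j + s" for j by (metis order_antisym order_refl)
  note step = this
  have "idx (j + T + T) = idx j + 2 * s" using step[of "j + T"] step[of j] by simp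
  then have "even (idx (j + T + T)) \<longleftrightarrow> even (idx j)" by simp
  moreover have "j + T + T = j + 2 * T" by simp
  ultimately show ?thesis unfolding even_idx T_def by metis
qed

text \<open>A repeated block of \<open>s < m\<close> entries gives the run lengths period
  \<open>s\<close>, and thus \<open>b\<close> the period \<open>2 * (st s - st 0)\<close>, which is
  positive and less than \<open>2n\<close>.\<close>

lemma not_periodic:
  assumes per: "\<And>T. (\<And>j. b (j + T) \<longleftrightarrow> b j) \<Longrightarrow> 2 * n dvd T"
    and "has_composition N P ks"
  shows "\<not> periodic_composition ks"
proof
  assume "periodic_composition ks"
  then obtain d xs where d: "d > 1" "ks = concat (replicate d xs)"
    by (auto simp: periodic_composition_def)
  obtain c e where len: "length ks = nat m" and e: "e \<in> {1, -1}"
    and nth: "\<And>i. i < nat m \<Longrightarrow> ks ! i = run_length (c + e * int i)"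
    using composition_unique[OF assms(2)] by blast
  define s where "s = length xs"
  have ds: "nat m = d * s"
    using len by (simp add: d s_def length_concat sum_list_replicate)
  have "s > 0" using ds m_pos by (cases s) auto
  have "s < d * s" using d(1) \<open>s > 0\<close> by simp
  then have sm: "int s < m" using ds by linarith
  have nat_per: "run_length (c + e * int i) = xs ! (i mod s)" for i
  proof -
    have "int (i mod nat m) = int i mod m" using m_pos by (simp add: zmod_int)
    then have "run_length (c + e * int i) = run_length (c + e * int (i mod nat m))"
      by (intro run_length_cong) (metis mod_add_right_eq mod_mult_right_eq)
    also have "\<dots> = ks ! (i mod nat m)" using m_pos by (intro nth[symmetric]) simp
    also have "\<dots> = xs ! (i mod nat m mod s)"
      unfolding d(2) s_def
    proof (rule nth_concat_replicate)
      show "i mod nat m < d * length xs" using m_pos ds s_def by (metis mod_less_divisor zero_less_nat_eq)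
    qed
    also have "i mod nat m mod s = i mod s" by (simp add: ds mod_mod_cancel)
    finally show ?thesis .
  qed
  have es: "run_length (k + e * int s) = run_length k" for k
  proof -
    \<comment> \<open>Solves \<open>c + e * i = k\<close> modulo \<open>m\<close>, using
      \<open>e * e = 1\<close>.\<close>
    define i where "i = nat ((e * (k - c)) mod m)"
    have i: "int i = (e * (k - c)) mod m" using m_pos by (simp add: i_def)
    have "e * e = 1" using e by auto
    then have "c + e * (e * (k - c)) = k" by (simp flip: mult.assoc)
    then have k: "(c + e * int i) mod m = k mod m"
      unfolding i by (metis mod_add_right_eq mod_mult_right_eq)
    have "run_length (k + e * int s) = run_length (c + e * int (i + s))"
    proof (rule run_length_cong)
      show "(k + e * int s) mod m = (c + e * int (i + s)) mod m"
        using k by (metis add.assoc distrib_left mod_add_left_eq of_nat_add)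
    qed
    also have "\<dots> = run_length (c + e * int i)" unfolding nat_per by simp
    also have "\<dots> = run_length k" using k by (rule run_length_cong)
    finally show ?thesis .
  qed
  have "run_length (k + int s) = run_length k" for k
    using es[of k] es[of "k + int s"] e by auto
  then have "2 * n dvd 2 * (st (int s) - st 0)"
    by (intro per b_period_if_run_length_period)
  then have "n dvd st (int s) - st 0" by (simp only: dvd_mult_cancel_left) simp
  moreover have "st 0 < st (int s)" using \<open>s > 0\<close> by simp
  ultimately have "n \<le> st (int s) - st 0" by (intro zdvd_imp_le) auto
  moreover have "st (int s) < st (0 + m * 1)" using sm by simp
  then have "st (int s) < st 0 + n" unfolding st_add_mk by simp
  ultimately show False by simp
qed

lemma sporadic:
  assumes "\<And>T. (\<And>j. b (j + T) \<longleftrightarrow> b j) \<Longrightarrow> 2 * n dvd T"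
  shows "sporadic_reinhardt_polygon (nat n) P"
  using not_periodic[OF assms] inscribed
  unfolding sporadic_reinhardt_polygon_def reinhardt_polygon_def periodic_polygon_def by blast

end

section \<open>Finiteness of the set of compositions and positivity of \<open>E1\<close>\<close>

lemma finite_compositions:
  assumes "n > 0"
  shows "finite {ks. \<exists>P. has_composition n P ks}"
proof (rule finite_subset)
  \<comment> \<open>Crude bounds suffice: a star has at most \<open>n\<close> vertices, and every
    face is the hull of one of the \<open>2 ^ n\<close> sets of vertices. Finiteness matters because
    \<open>card\<close> of an infinite set is 0.\<close>
  show "finite {ks. set ks \<subseteq> {..(2::nat) ^ n} \<and> length ks \<le> n}"
    by (intro finite_lists_length_le) simp
  show "{ks. \<exists>P. has_composition n P ks} \<subseteq> {ks. set ks \<subseteq> {..2 ^ n} \<and> length ks \<le> n}"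
  proof safe
    fix ks P assume "has_composition n P ks"
    then obtain R V ws where ins: "reinhardt_inscribed n P R V" and star: "star_traversal R V ws"
      and ks: "ks = map (\<lambda>v. sides_in_arc P (opposite_arc R v)) ws"
      unfolding has_composition_def by blast
    have P: "polytope P" "card (vertices P) = n" "V \<subseteq> vertices P"
      using ins by (auto simp: reinhardt_inscribed_def convex_ngon_def)
    have fin: "finite (vertices P)" using P(2) assms by (metis card.infinite less_irrefl)
    have "length ws = card V" using star distinct_card[of ws] by (auto simp: star_traversal_def)
    also have "\<dots> \<le> n" using card_mono[OF fin P(3)] P(2) by simp
    finally show "length ks \<le> n" by (simp add: ks)
    have hull: "P = convex hull (vertices P)"
      unfolding vertices_def using P(1)
      by (intro Krein_Milman_Minkowski polytope_imp_compact polytope_imp_convex)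
    have faces: "{e. e face_of P} \<subseteq> (\<lambda>S. convex hull S) ` Pow (vertices P)"
    proof
      fix e assume "e \<in> {e. e face_of P}"
      then have "e face_of convex hull (vertices P)" using hull by simp
      then obtain S where "S \<subseteq> vertices P" "e = convex hull S"
        using face_of_convex_hull_subset[of "vertices P" e] fin finite_imp_compact by blast
      then show "e \<in> (\<lambda>S. convex hull S) ` Pow (vertices P)" by blast
    qed
    fix k assume "k \<in> set ks"
    then obtain v where "k = sides_in_arc P (opposite_arc R v)" by (auto simp: ks)
    also have "\<dots> \<le> card ((\<lambda>S. convex hull S) ` Pow (vertices P))"
      unfolding sides_in_arc_def using fin faces by (intro card_mono) (auto simp: edge_of_def)
    also have "\<dots> \<le> card (Pow (vertices P))" using fin by (intro card_image_le) simp
    also have "\<dots> = 2 ^ n" using fin P(2) by (simp add: card_Pow)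
    finally show "k \<le> 2 ^ n" .
  qed
qed

lemma E1_pos:
  assumes "n > 0" "sporadic_reinhardt_polygon n P" "has_composition n P ks"
  shows "E1 n > 0"
proof -
  let ?A = "{ks. \<exists>P. sporadic_reinhardt_polygon n P \<and> has_composition n P ks}"
  have "finite ?A" by (rule finite_subset[OF _ finite_compositions[OF assms(1)]]) blast
  moreover have "{dihedral_class ks | ks. \<exists>P. sporadic_reinhardt_polygon n P \<and> has_composition n P ks}
      = dihedral_class ` ?A" by blast
  moreover have "?A \<noteq> {}" using assms by blast
  ultimately show ?thesis unfolding E1_def by (simp add: card_gt_0_iff)
qed

subsection \<open>A word without proper period\<close>

text \<open>Shifting the summation index by \<open>s\<close> permutes a full period and multiplies
  the sum by \<open>z\<close>, which is not 1.\<close>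

lemma sum_shift_eq_0:
  fixes g :: "int \<Rightarrow> complex"
  assumes "L > 0" "\<And>j. g (j + L) = g j" "\<And>j. g (j + s) = z * g j" "z \<noteq> 1"
  shows "(\<Sum>j\<in>{0..<L}. g j) = 0"
proof -
  have g_mod: "g (j mod L) = g j" for j
    using periodic_int_mult[where f=g and c=L and j="j mod L" and k="j div L"] assms(2) by simp
  have inj: "inj_on (\<lambda>j. (j + s) mod L) {0..<L}"
  proof (rule inj_onI)
    fix x y assume xy: "x \<in> {0..<L}" "y \<in> {0..<L}" "(x + s) mod L = (y + s) mod L"
    then have "L dvd x - y" by (simp add: mod_eq_dvd_iff)
    then have "x mod L = y mod L" by (simp only: mod_eq_dvd_iff)
    then show "x = y" using xy by simp
  qed
  moreover have "(\<lambda>j. (j + s) mod L) ` {0..<L} = {0..<L}"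
    using assms(1) by (intro endo_inj_surj inj) auto
  ultimately have "(\<Sum>j\<in>{0..<L}. g j) = (\<Sum>j\<in>{0..<L}. g ((j + s) mod L))"
    using sum.reindex[of "\<lambda>j. (j + s) mod L" "{0..<L}" g] by (simp add: comp_def)
  also have "\<dots> = z * (\<Sum>j\<in>{0..<L}. g j)" by (simp add: g_mod assms(3) sum_distrib_left)
  finally have "(1 - z) * (\<Sum>j\<in>{0..<L}. g j) = 0" by (simp add: algebra_simps)
  then show ?thesis using assms(4) by simp
qed

lemma cis_neq_1:
  assumes "p \<ge> (2::int)"
  shows "cis (2 * pi / of_int p) \<noteq> 1"
proof
  assume "cis (2 * pi / of_int p) = 1"
  then have "cos (2 * pi / of_int p) = 1" by (metis cis.sel(1) one_complex.sel(1))
  then obtain k where "2 * pi / of_int p = of_int k * 2 * pi" using cos_one_2pi_int by blast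
  then have "1 = real_of_int (k * p)" using assms by (simp add: field_simps)
  then have "k * p = 1" by linarith
  then show False using assms by (metis dvd_triv_right zdvd1_eq abs_of_nonneg linorder_not_le one_less_numeral_iff order_less_le_trans semiring_norm(76) verit_comp_simplify1(1) zero_le_numeral order_trans)
qed

text \<open>This is the word of alternating blocks of length \<open>P\<close>. A nonzero remainder
  \<open>e\<close> of \<open>T\<close> carries position 0 (if \<open>e \<ge> P\<close>) or position
  \<open>P - 1\<close> (otherwise) into the next block.\<close>

lemma even_div_period:
  assumes "P > 0" "\<And>t. even ((t + T) div P) \<longleftrightarrow> even (t div P)"
  shows "2 * P dvd (T::int)"
proof (rule ccontr)
  assume "\<not> 2 * P dvd T"
  define e where "e = T mod (2 * P)"
  have e: "0 < e" "e < 2 * P"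
    using \<open>\<not> 2 * P dvd T\<close> assms(1) pos_mod_bound[of "2 * P" T] pos_mod_sign[of "2 * P" T]
    by (auto simp: e_def dvd_eq_mod_eq_0 order_less_le)
  have T: "T = e + P * (2 * (T div (2 * P)))"
    using mod_mult_div_eq[of T "2 * P"] by (simp add: e_def mult.assoc mult.left_commute)
  have "(t + T) div P = (t + e) div P + 2 * (T div (2 * P))" for t
    using assms(1) by (subst T) (simp flip: add.assoc)
  then have per: "even ((t + e) div P) \<longleftrightarrow> even (t div P)" for t
    using assms(2)[of t] by simp
  show False
  proof (cases "e \<ge> P")
    case True
    then have "e div P = 1" using e by (intro int_div_pos_eq[of _ _ _ "e - P"]) auto
    then show False using per[of 0] by simp
  next
    case False
    then have "(P - 1 + e) div P = 1" using e by (intro int_div_pos_eq[of _ _ _ "e - 1"]) auto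
    then show False using per[of "P - 1"] assms(1) by (simp add: div_pos_pos_trivial)
  qed
qed

text \<open>On multiples of \<open>r\<close> the word has period \<open>2 q r\<close>, elsewhere period \<open>2 p r\<close>.  Each part
  is annihilated on its own, by a \<open>p\<close>-th and a \<open>q\<close>-th root of unity respectively, but the
  two periods have no common multiple below \<open>2 p q r\<close>.\<close>

definition mixed_word :: "int \<Rightarrow> int \<Rightarrow> int \<Rightarrow> int \<Rightarrow> bool" where
  "mixed_word p q r j \<longleftrightarrow> even (j div (if r dvd j then q * r else p * r))"

lemma mixed_word_mult: "r > 0 \<Longrightarrow> mixed_word p q r (r * t) \<longleftrightarrow> even (t div q)"
  by (simp add: mixed_word_def mult.commute[of q])

lemma mixed_word_nmult:
  assumes "p \<ge> 0" "\<not> r dvd j"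
  shows "mixed_word p q r j \<longleftrightarrow> even (j div r div p)"
proof -
  have "j div (r * p) = j div r div p" using assms(1) by (rule zdiv_zmult2_eq)
  then show ?thesis using assms(2) by (simp add: mixed_word_def mult.commute)
qed

text \<open>If \<open>r\<close> did not divide \<open>T\<close>, the shift would match the blocks of
  length \<open>q\<close> on the multiples of \<open>r\<close> with blocks of length
  \<open>p\<close>, forcing \<open>q dvd p\<close>. So \<open>T = r * T'\<close>, and
  \<open>T'\<close> is a period of both block words.\<close>

lemma mixed_word_period:
  assumes "prime p" "prime q" "p \<noteq> q" "odd p" "odd q" "r \<ge> 2"
    and per: "\<And>j. mixed_word p q r (j + T) \<longleftrightarrow> mixed_word p q r j"
  shows "2 * (p * q * r) dvd T"
proof -
  have pos: "p > 0" "q > 0" "r > 0" using assms by (auto simp: prime_gt_0_int)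
  have "r dvd T"
  proof (rule ccontr)
    assume nr: "\<not> r dvd T"
    define c where "c = T div r"
    have "even ((t + c) div p) \<longleftrightarrow> even (t div q)" for t
    proof -
      have "\<not> r dvd r * t + T" using nr by (simp add: dvd_add_right_iff)
      moreover have "(r * t + T) div r = t + c" using pos by (simp add: c_def)
      ultimately show ?thesis
        using per[of "r * t"] mixed_word_nmult[of p r "r * t + T"] mixed_word_mult[of r p q t] pos by simp
    qed
    note * = this
    have "even ((t + 2 * p) div q) \<longleftrightarrow> even (t div q)" for t
    proof -
      have "(t + 2 * p + c) div p = (t + c) div p + 2"
      proof -
        have "t + 2 * p + c = t + c + p * 2" by simp
        then show ?thesis using pos by (simp only: div_mult_self2)
      qed
      then show ?thesis using *[of t] *[of "t + 2 * p"] by simp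
    qed
    then have "2 * q dvd 2 * p" using pos by (intro even_div_period)
    then have "q dvd p" by simp
    then show False using assms primes_dvd_imp_eq by metis
  qed
  then obtain T' where T: "T = r * T'" by blast
  have "even ((t + T') div q) \<longleftrightarrow> even (t div q)" for t
    using per[of "r * t"] mixed_word_mult[of r p q t] mixed_word_mult[of r p q "t + T'"] pos
    by (simp add: T distrib_left)
  then have q: "2 * q dvd T'" using pos by (intro even_div_period)
  have "even ((t + T') div p) \<longleftrightarrow> even (t div p)" for t
  proof -
    \<comment> \<open>As \<open>r \<ge> 2\<close>, the positions \<open>r * u + 1\<close> avoid the
      multiples of \<open>r\<close> and display the blocks of length \<open>p\<close>.\<close>
    have nd: "\<not> r dvd r * u + 1" for u using assms(6) by (simp add: dvd_add_right_iff zdvd1_eq)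
    have dr: "(r * u + 1) div r = u" for u using assms(6) by (simp add: div_pos_pos_trivial)
    have "r * t + 1 + T = r * (t + T') + 1" by (simp add: T algebra_simps)
    then show ?thesis
      using per[of "r * t + 1"] mixed_word_nmult[OF less_imp_le[OF pos(1)] nd, of q t]
        mixed_word_nmult[OF less_imp_le[OF pos(1)] nd, of q "t + T'"] by (simp only: dr)
  qed
  then have "2 * p dvd T'" using pos by (intro even_div_period)
  then have "p dvd T'" by (metis dvd_mult_right)
  moreover have "coprime p q" using assms by (simp add: primes_coprime)
  then have "coprime p (2 * q)" using assms(4) by (simp add: coprime_mult_right_iff coprime_commute)
  ultimately have "p * (2 * q) dvd T'" using q by (simp add: divides_mult)
  then have "r * (p * (2 * q)) dvd T" unfolding T by (rule mult_dvd_mono[OF dvd_refl])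
  then show ?thesis by (simp add: mult.assoc mult.commute mult.left_commute)
qed

text \<open>The shift is by \<open>p\<close> blocks of length \<open>q * r\<close> or by
  \<open>q\<close> blocks of length \<open>p * r\<close>, an odd number in either case.\<close>

lemma mixed_word_add_n:
  assumes "p > 0" "q > 0" "r > 0" "odd p" "odd q"
  shows "mixed_word p q r (j + p * q * r) \<longleftrightarrow> \<not> mixed_word p q r j"
proof (cases "r dvd j")
  case True
  then have "r dvd j + p * q * r" by simp
  moreover have "(j + p * q * r) div (q * r) = j div (q * r) + p"
    using assms by (simp add: mult.assoc)
  ultimately show ?thesis using assms True by (simp add: mixed_word_def)
next
  case False
  then have "\<not> r dvd j + p * q * r" by (simp add: dvd_add_left_iff)
  moreover have "p * q * r = q * (p * r)" by simp
  then have "(j + p * q * r) div (p * r) = j div (p * r) + q"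
    using assms by (simp only: div_mult_self1) simp
  ultimately show ?thesis using assms False by (simp add: mixed_word_def)
qed

lemma mixed_word_sum:
  assumes "p \<ge> 2" "q \<ge> 2" "r > 0" "odd p" "odd q"
  defines "n \<equiv> p * q * r"
  shows "(\<Sum>j\<in>{0..<2*n}. of_bool (mixed_word p q r j) * cis (pi * of_int j / of_int n)) = 0"
proof -
  have n: "n > 0" using assms by (simp add: n_def)
  define h where "h j = of_bool (mixed_word p q r j) * cis (pi * of_int j / of_int n)" for j
  have w2n: "mixed_word p q r (j + 2 * n) = mixed_word p q r j" for j
  proof -
    have "mixed_word p q r (i + n) \<longleftrightarrow> \<not> mixed_word p q r i" for i
      unfolding n_def using assms(1-5) by (intro mixed_word_add_n) auto
    from this[of j] this[of "j + n"] show ?thesis by (simp add: add.assoc)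
  qed
  have cis_shift: "cis (pi * of_int (j + s) / of_int n) = cis (pi * of_int s / of_int n) * cis (pi * of_int j / of_int n)" for j s
    unfolding cis_mult by (rule arg_cong[where f=cis]) (simp add: add_divide_distrib distrib_left)
  have h2n: "h (j + 2 * n) = h j" for j
  proof -
    have "pi * of_int (2 * n) / of_int n = 2 * pi" using n by simp
    then show ?thesis using cis_shift[of j "2 * n"] by (simp add: h_def w2n del: of_int_add of_int_mult)
  qed
  have 1: "(\<Sum>j\<in>{0..<2*n}. if r dvd j then h j else 0) = 0"
  \<comment> \<open>A shift by two blocks keeps the word on the multiples of \<open>r\<close> and
    multiplies each term by a primitive \<open>p\<close>-th root of unity.\<close>
  proof (rule sum_shift_eq_0[where s="2 * q * r" and z="cis (2 * pi / of_int p)"])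
    have nd: "r dvd j + 2 * n \<longleftrightarrow> r dvd j" for j by (simp add: n_def dvd_add_left_iff)
    show "(if r dvd j + 2 * n then h (j + 2 * n) else 0) = (if r dvd j then h j else 0)" for j
      by (simp add: h2n nd)
    have sd: "r dvd j + 2 * q * r \<longleftrightarrow> r dvd j" for j by (simp add: dvd_add_left_iff)
    have "mixed_word p q r (j + 2 * q * r) = mixed_word p q r j" if "r dvd j" for j
    proof -
      have "(j + 2 * q * r) div (q * r) = j div (q * r) + 2"
        using assms by (simp add: mult.assoc)
      then show ?thesis using that by (simp add: mixed_word_def)
    qed
    moreover have "pi * of_int (2 * q * r) / of_int n = 2 * pi / of_int p"
      using assms(1-3) by (simp add: n_def field_simps)
    ultimately show "(if r dvd j + 2 * q * r then h (j + 2 * q * r) else 0)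
        = cis (2 * pi / of_int p) * (if r dvd j then h j else 0)" for j
      by (simp add: sd h_def cis_shift del: of_int_add of_int_mult)
  qed (use n cis_neq_1[OF assms(1)] in auto)
  have 2: "(\<Sum>j\<in>{0..<2*n}. if r dvd j then 0 else h j) = 0"
  proof (rule sum_shift_eq_0[where s="2 * p * r" and z="cis (2 * pi / of_int q)"])
    have nd: "r dvd j + 2 * n \<longleftrightarrow> r dvd j" for j by (simp add: n_def dvd_add_left_iff)
    show "(if r dvd j + 2 * n then 0 else h (j + 2 * n)) = (if r dvd j then 0 else h j)" for j
      by (simp add: h2n nd)
    have sd: "r dvd j + 2 * p * r \<longleftrightarrow> r dvd j" for j by (simp add: dvd_add_left_iff)
    have "mixed_word p q r (j + 2 * p * r) = mixed_word p q r j" if "\<not> r dvd j" for j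
    proof -
      have "(j + 2 * p * r) div (p * r) = j div (p * r) + 2"
        using assms by (simp add: mult.assoc)
      then show ?thesis using that sd by (simp add: mixed_word_def)
    qed
    moreover have "pi * of_int (2 * p * r) / of_int n = 2 * pi / of_int q"
      using assms(1-3) by (simp add: n_def field_simps)
    ultimately show "(if r dvd j + 2 * p * r then 0 else h (j + 2 * p * r))
        = cis (2 * pi / of_int q) * (if r dvd j then 0 else h j)" for j
      by (simp add: sd h_def cis_shift del: of_int_add of_int_mult)
  qed (use n cis_neq_1[OF assms(2)] in auto)
  have "(\<Sum>j\<in>{0..<2*n}. h j) =
      (\<Sum>j\<in>{0..<2*n}. (if r dvd j then h j else 0) + (if r dvd j then 0 else h j))"
    by (intro sum.cong) auto
  then have "(\<Sum>j\<in>{0..<2*n}. h j) = 0" by (simp only: sum.distrib 1 2 add_0)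
  then show ?thesis by (simp add: h_def)
qed

theorem theorem1p2:
  fixes n p q r :: nat
  assumes "prime p" "odd p" "prime q" "odd q" "p \<noteq> q"
    and "2 \<le> r"
    and "n = p * q * r"
  shows "(\<exists>P. sporadic_reinhardt_polygon n P) \<and> E1 n > 0"
proof -
  have pq: "p \<ge> 2" "q \<ge> 2" using assms by (auto simp: prime_ge_2_nat)
  have n: "int n = int p * int q * int r" using assms by simp
  have "n > 0" using assms pq by simp
  have n2: "2 \<le> int n"
  proof -
    have "p dvd n" using assms by simp
    then have "p \<le> n" using \<open>n > 0\<close> by (rule dvd_imp_le)
    then show ?thesis using pq by simp
  qed
  interpret reinhardt_word "int n" "mixed_word (int p) (int q) (int r)"
  proof
    show "mixed_word (int p) (int q) (int r) (j + int n) \<longleftrightarrow> \<not> mixed_word (int p) (int q) (int r) j" for j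
      unfolding n using assms pq by (intro mixed_word_add_n) auto
    show "(\<Sum>j\<in>{0..<2 * int n}. of_bool (mixed_word (int p) (int q) (int r) j) *
        cis (pi * of_int j / of_int (int n))) = 0"
      unfolding n using assms pq by (intro mixed_word_sum) auto
  qed (use n2 in \<open>auto simp: mixed_word_def\<close>)
  have per: "2 * int n dvd T"
    if "\<And>j. mixed_word (int p) (int q) (int r) (j + T) \<longleftrightarrow> mixed_word (int p) (int q) (int r) j" for T
    unfolding n using assms that by (intro mixed_word_period) auto
  have "sporadic_reinhardt_polygon n P" using sporadic[OF per] by simp
  moreover from this have "E1 n > 0"
    using E1_pos[OF \<open>n > 0\<close>] has_composition_ws0 by simp
  ultimately show ?thesis by blast
qed

end
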